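(* Let $g_{ij}$ be the metric of an $n$-dimensional Riemannian space with coordinates $x^k$, let $\Delta$ be its Laplace operator, and let $f=f(x^i,u)$ be a function of the coordinates and of $u$. The Lie point symmetries of the Poisson equation $$\Delta u-f(x^i,u)=0$$ are generated from the conformal Killing vectors (CKVs) of the metric $g_{ij}$ as follows. (a) For $n>2$, the Lie point symmetry vector is $$X=\xi^i(x^k)\,\partial_i+\left(\frac{2-n}{2}\,\psi(x^k)\,u+a_0u+b(x^k)\right)\partial_u ,$$ where $a_0$ is a constant, $b(x^k)$ is a function, $\xi^i(x^k)$ is a CKV of $g_{ij}$ with conformal factor $\psi(x^k)$, and the following condition holds: $$\frac{2-n}{2}\,(\Delta\psi)\,u+g^{ij}b_{;ij}-\xi^kf_{,k}-\frac{2-n}{2}\,\psi\,u f_{,u}-\frac{n+2}{2}\,\psi f-b f_{,u}=0 .$$ (b) For $n=2$, the Lie point symmetry vector is $$X=\xi^i(x^k)\,\partial_i+\left(a_0u+b(x^k)\right)\partial_u ,$$ where $a_0$ is a constant, $\xi^i(x^k)$ is a CKV of $g_{ij}$ with conformal factor $\psi(x^k)$ (i.e. $L_\xi g_{ij}=2\psi(x^k)g_{ij}$), and the following condition holds: $$g^{ij}b_{;ij}-\xi^kf_{,k}-a_0uf_{,u}+(a_0-2\psi)f-bf_{,u}=0 ,$$ where the function $b(x^k)$ is a solution of the Laplace equation $\Delta b=0$.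
   Context: "Riemannian space" means a space with a smooth nondegenerate metric $g_{ij}$ (indefinite signature, e.g. Lorentzian, is allowed). The Laplace operator is $\Delta u=\frac{1}{\sqrt{|g|}}\frac{\partial}{\partial x^i}\left(\sqrt{|g|}\,g^{ij}\frac{\partial u}{\partial x^j}\right)=g^{ij}u_{ij}-\Gamma^iu_i$, where $\Gamma^i=g^{jk}\Gamma^i_{jk}$, $\Gamma^i_{jk}$ are the Christoffel symbols of $g_{ij}$, and $u_i,u_{ij}$ are partial derivatives. A semicolon denotes covariant differentiation and a comma partial differentiation; $f_{,k}=\partial f/\partial x^k$ with $u$ held fixed and $f_{,u}=\partial f/\partial u$. Repeated indices are summed. A vector field $\xi^i$ is a CKV of $g_{ij}$ with conformal factor $\psi$ if $L_\xi g_{ij}=2\psi g_{ij}$, where $L_\xi$ is the Lie derivative; Killing vectors ($\psi=0$) and homothetic vectors ($\psi$ constant) are included. Lie point symmetry: a vector field $X=\xi^i(x^k,u)\partial_i+\eta(x^k,u)\partial_u$ is (the generator of) a Lie point symmetry of a second-order PDE $H(x^i,u,u_i,u_{ij})=0$ if there is a function $\lambda$ such that $X^{[2]}H=\lambda H$, modulo $H=0$. Here $X^{[2]}=X+\eta_{[i]}\partial_{u_i}+\eta_{[ij]}\partial_{u_{ij}}$ is the second prolongation, with $\eta_{[i]}=D_i\eta-u_jD_i\xi^j$, $\eta_{[ij]}=D_j\eta_{[i]}-u_{ik}D_j\xi^k$, and $D_i$ the total derivative with respect to $x^i$.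
   Formalization: In (a) the condition gains the missing terms −a₀u f_{,u} + a₀f (without them it fails, e.g. flat R³, f=u², X=u∂_u); in (b) the clause Δb=0 is dropped, since it fails for symmetries such as e^{x¹}∂_u with f=u on flat R². *)

theory Defs
  imports "HOL-Analysis.Analysis"
begin

section \<open>Smooth functions on open sets\<close>

primrec Ck_on :: "nat \<Rightarrow> 'a::euclidean_space set \<Rightarrow> ('a \<Rightarrow> 'b::real_normed_vector) \<Rightarrow> bool" where
  "Ck_on 0 S F \<longleftrightarrow> continuous_on S F"
| "Ck_on (Suc k) S F \<longleftrightarrow>
     (\<forall>x\<in>S. F differentiable (at x)) \<and> (\<forall>v. Ck_on k S (\<lambda>x. frechet_derivative F (at x) v))"

definition smooth_on :: "'a::euclidean_space set \<Rightarrow> ('a \<Rightarrow> 'b::real_normed_vector) \<Rightarrow> bool" where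
  "smooth_on S F \<longleftrightarrow> (\<forall>k. Ck_on k S F)"

section \<open>Metric geometry in a coordinate domain\<close>

definition pd :: "'n::finite \<Rightarrow> (real^'n \<Rightarrow> real) \<Rightarrow> real^'n \<Rightarrow> real" where
  "pd i F x = frechet_derivative F (at x) (axis i 1)"

text \<open>The metric is given by its component matrix; its signature is arbitrary.\<close>

definition metric_on :: "(real^'n::finite) set \<Rightarrow> (real^'n \<Rightarrow> real^'n^'n) \<Rightarrow> bool" where
  "metric_on U g \<longleftrightarrow>
     smooth_on U g \<and> (\<forall>x\<in>U. transpose (g x) = g x \<and> det (g x) \<noteq> 0)"

definition ginv :: "(real^'n::finite \<Rightarrow> real^'n^'n) \<Rightarrow> real^'n \<Rightarrow> 'n \<Rightarrow> 'n \<Rightarrow> real" where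
  "ginv g x i j = matrix_inv (g x) $ i $ j"

text \<open>\<open>christoffel g i j k\<close> is \<open>\<Gamma>\<^sup>i\<close> with lower indices \<open>j\<close>, \<open>k\<close>.\<close>

definition christoffel ::
    "(real^'n::finite \<Rightarrow> real^'n^'n) \<Rightarrow> 'n \<Rightarrow> 'n \<Rightarrow> 'n \<Rightarrow> real^'n \<Rightarrow> real" where
  "christoffel g i j k x =
     (\<Sum>l\<in>UNIV. ginv g x i l *
        (pd k (\<lambda>y. g y $ l $ j) x + pd j (\<lambda>y. g y $ l $ k) x - pd l (\<lambda>y. g y $ j $ k) x)) / 2"

definition contracted_christoffel ::
    "(real^'n::finite \<Rightarrow> real^'n^'n) \<Rightarrow> 'n \<Rightarrow> real^'n \<Rightarrow> real" where
  "contracted_christoffel g i x =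
     (\<Sum>j\<in>UNIV. \<Sum>k\<in>UNIV. ginv g x j k * christoffel g i j k x)"

definition laplacian ::
    "(real^'n::finite \<Rightarrow> real^'n^'n) \<Rightarrow> (real^'n \<Rightarrow> real) \<Rightarrow> real^'n \<Rightarrow> real" where
  "laplacian g w x =
     (\<Sum>i\<in>UNIV. \<Sum>j\<in>UNIV. ginv g x i j * pd j (pd i w) x)
     - (\<Sum>i\<in>UNIV. contracted_christoffel g i x * pd i w x)"

definition cov_hessian ::
    "(real^'n::finite \<Rightarrow> real^'n^'n) \<Rightarrow> (real^'n \<Rightarrow> real) \<Rightarrow> 'n \<Rightarrow> 'n \<Rightarrow> real^'n \<Rightarrow> real" where
  "cov_hessian g w i j x = pd j (pd i w) x - (\<Sum>k\<in>UNIV. christoffel g k i j x * pd k w x)"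

definition lie_deriv_metric ::
    "(real^'n::finite \<Rightarrow> real^'n) \<Rightarrow> (real^'n \<Rightarrow> real^'n^'n) \<Rightarrow> 'n \<Rightarrow> 'n \<Rightarrow> real^'n \<Rightarrow> real" where
  "lie_deriv_metric \<xi> g i j x =
     (\<Sum>k\<in>UNIV. \<xi> x $ k * pd k (\<lambda>y. g y $ i $ j) x
        + g x $ k $ j * pd i (\<lambda>y. \<xi> y $ k) x
        + g x $ i $ k * pd j (\<lambda>y. \<xi> y $ k) x)"

definition conformal_killing ::
    "(real^'n::finite) set \<Rightarrow> (real^'n \<Rightarrow> real^'n^'n) \<Rightarrow> (real^'n \<Rightarrow> real^'n) \<Rightarrow> (real^'n \<Rightarrow> real) \<Rightarrow> bool" where
  "conformal_killing U g \<xi> \<psi> \<longleftrightarrow>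
     smooth_on U \<xi> \<and> smooth_on U \<psi> \<and>
     (\<forall>x\<in>U. \<forall>i j. lie_deriv_metric \<xi> g i j x = 2 * \<psi> x * g x $ i $ j)"

section \<open>Jets, prolongation and Lie point symmetries\<close>

text \<open>A point of the second jet space is \<open>(x, u, p, q)\<close> with \<open>p $ i\<close> standing for \<open>u\<^sub>i\<close> and
  \<open>q $ i $ j\<close> for \<open>u\<^sub>i\<^sub>j\<close>. Matrices \<open>q\<close> that are not symmetric belong to the type but not to the
  jet space; the symmetry condition below is imposed at symmetric \<open>q\<close> only.\<close>

type_synonym 'n jet0 = "(real^'n) \<times> real"
type_synonym 'n jet1 = "(real^'n) \<times> real \<times> (real^'n)"
type_synonym 'n jet2 = "(real^'n) \<times> real \<times> (real^'n) \<times> (real^'n^'n)"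

definition pdx :: "'n::finite \<Rightarrow> ('n jet0 \<Rightarrow> real) \<Rightarrow> 'n jet0 \<Rightarrow> real" where
  "pdx i F z = frechet_derivative F (at z) (axis i 1, 0)"

definition pdu :: "('n::finite jet0 \<Rightarrow> real) \<Rightarrow> 'n jet0 \<Rightarrow> real" where
  "pdu F z = frechet_derivative F (at z) (0, 1)"

text \<open>Total derivatives of functions of \<open>(x, u)\<close> and of \<open>(x, u, p)\<close>: the direction vectors encode
  \<open>\<partial>\<^sub>i + u\<^sub>i \<partial>\<^sub>u\<close> and \<open>\<partial>\<^sub>i + u\<^sub>i \<partial>\<^sub>u + u\<^sub>i\<^sub>j \<partial>/\<partial>u\<^sub>j\<close>.\<close>

fun total_deriv0 :: "'n::finite \<Rightarrow> ('n jet0 \<Rightarrow> real) \<Rightarrow> 'n jet1 \<Rightarrow> real" where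
  "total_deriv0 i F (x, u, p) = frechet_derivative F (at (x, u)) (axis i 1, p $ i)"

fun total_deriv1 :: "'n::finite \<Rightarrow> ('n jet1 \<Rightarrow> real) \<Rightarrow> 'n jet2 \<Rightarrow> real" where
  "total_deriv1 i F (x, u, p, q) =
     frechet_derivative F (at (x, u, p)) (axis i 1, p $ i, q $ i)"

fun prolong1 ::
    "('n::finite jet0 \<Rightarrow> real^'n) \<Rightarrow> ('n jet0 \<Rightarrow> real) \<Rightarrow> 'n \<Rightarrow> 'n jet1 \<Rightarrow> real" where
  "prolong1 \<xi> \<eta> i (x, u, p) =
     total_deriv0 i \<eta> (x, u, p)
     - (\<Sum>j\<in>UNIV. p $ j * total_deriv0 i (\<lambda>z. \<xi> z $ j) (x, u, p))"

fun prolong2 ::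
    "('n::finite jet0 \<Rightarrow> real^'n) \<Rightarrow> ('n jet0 \<Rightarrow> real) \<Rightarrow> 'n \<Rightarrow> 'n \<Rightarrow> 'n jet2 \<Rightarrow> real" where
  "prolong2 \<xi> \<eta> i j (x, u, p, q) =
     total_deriv1 j (prolong1 \<xi> \<eta> i) (x, u, p, q)
     - (\<Sum>k\<in>UNIV. q $ i $ k * total_deriv0 j (\<lambda>z. \<xi> z $ k) (x, u, p))"

text \<open>The second prolongation applied to \<open>H\<close>, i.e. the derivative of \<open>H\<close> along the vector field
  with components \<open>\<xi>\<close>, \<open>\<eta>\<close>, \<open>\<eta>\<^sub>[\<^sub>i\<^sub>]\<close>, \<open>\<eta>\<^sub>[\<^sub>i\<^sub>j\<^sub>]\<close>.\<close>

fun second_prolongation ::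
    "('n::finite jet0 \<Rightarrow> real^'n) \<Rightarrow> ('n jet0 \<Rightarrow> real) \<Rightarrow> ('n jet2 \<Rightarrow> real) \<Rightarrow> 'n jet2 \<Rightarrow> real" where
  "second_prolongation \<xi> \<eta> H (x, u, p, q) =
     frechet_derivative H (at (x, u, p, q))
       (\<xi> (x, u), \<eta> (x, u),
        (\<chi> i. prolong1 \<xi> \<eta> i (x, u, p)),
        (\<chi> i j. prolong2 \<xi> \<eta> i j (x, u, p, q)))"

text \<open>The multiplier \<open>\<mu>\<close> is an arbitrary function on the jet space, so the condition says precisely
  that the prolonged field annihilates \<open>H\<close> wherever \<open>H = 0\<close>.\<close>

definition lie_point_symmetry ::
    "'n::finite jet0 set \<Rightarrow> ('n jet2 \<Rightarrow> real) \<Rightarrow> ('n jet0 \<Rightarrow> real^'n) \<Rightarrow> ('n jet0 \<Rightarrow> real) \<Rightarrow> bool" where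
  "lie_point_symmetry S H \<xi> \<eta> \<longleftrightarrow>
     (\<exists>\<mu>. \<forall>x u p q. (x, u) \<in> S \<and> transpose q = q \<longrightarrow>
        second_prolongation \<xi> \<eta> H (x, u, p, q) = \<mu> (x, u, p, q) * H (x, u, p, q))"

fun poisson_eq ::
    "(real^'n::finite \<Rightarrow> real^'n^'n) \<Rightarrow> ('n jet0 \<Rightarrow> real) \<Rightarrow> 'n jet2 \<Rightarrow> real" where
  "poisson_eq g f (x, u, p, q) =
     (\<Sum>i\<in>UNIV. \<Sum>j\<in>UNIV. ginv g x i j * q $ i $ j)
     - (\<Sum>i\<in>UNIV. contracted_christoffel g i x * p $ i) - f (x, u)"

lemma poisson_eq_jet:
  "poisson_eq g f (x, w x, (\<chi> i. pd i w x), (\<chi> i j. pd j (pd i w) x)) =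
     laplacian g w x - f (x, w x)"
  by (simp add: laplacian_def)

end

theory Submission
  imports Defs
begin

text \<open>
  At a fixed point \<open>(x, u, p)\<close> of the first jet space, the prolonged field applied to the equation is
  an affine function of the symmetric matrix \<open>q\<close> of second-order coordinates: a linear form with
  coefficients \<open>C\<^sup>i\<^sup>j\<close> plus a term without \<open>q\<close>. It has to vanish on the
  hyperplane \<open>g\<^sup>i\<^sup>j q\<^sub>i\<^sub>j = \<Gamma>\<^sup>i p\<^sub>i + f\<close>, so for some factor \<open>l\<close>
  the linear form is \<open>l\<close> times \<open>g\<^sup>i\<^sup>j q\<^sub>i\<^sub>j\<close> and the other term is
  \<open>- l (\<Gamma>\<^sup>i p\<^sub>i + f)\<close> (lemma \<open>symmetric_form_proportional\<close>). What remains is a comparison of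
  powers of \<open>p\<close>.

  The part of \<open>C\<^sup>i\<^sup>j\<close> that is linear in \<open>p\<close> says that
  \<open>P\<^sup>i w\<^sup>j + P\<^sup>j w\<^sup>i\<close> is a multiple of \<open>g\<^sup>i\<^sup>j\<close>, where \<open>w = \<partial>\<^sub>u \<xi>\<close>
  and \<open>P\<close> is \<open>p\<close> with its index raised. For \<open>P = w\<close> the left-hand side has rank at most one, while
  the inverse metric has rank \<open>n \<ge> 2\<close>; hence \<open>\<partial>\<^sub>u \<xi> = 0\<close>. Now \<open>l\<close> does not
  depend on \<open>p\<close>, the quadratic part \<open>\<partial>\<^sub>u\<partial>\<^sub>u \<eta> g\<^sup>i\<^sup>j p\<^sub>i p\<^sub>j\<close> of the
  remaining term has nothing to balance it, and \<open>\<eta> = c(x) u + b(x)\<close> because \<open>J\<close> is an interval. The rest of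
  the condition on \<open>C\<^sup>i\<^sup>j\<close> states that the Lie derivative of the inverse metric is a multiple of it,
  that is, \<open>\<xi>\<close> is a conformal Killing vector with \<open>2 \<psi> = c - l\<close>
  (lemma \<open>conformal_killing_iff_raised\<close>).

  The terms linear in \<open>p\<close> contain second derivatives of \<open>\<xi>\<close> and first derivatives of
  \<open>\<Gamma>\<^sup>i\<close>. They form the trace of the Lie derivative of the Christoffel symbols, which for a
  conformal Killing vector is \<open>(2 - n) g\<^sup>i\<^sup>l \<psi>\<^sub>,\<^sub>l\<close>
  (lemma \<open>lie_derivative_contracted_christoffel\<close>). Consequently (lemma \<open>second_prolongation_conformal\<close>), for
  affine \<open>\<eta>\<close> and conformal \<open>\<xi>\<close> the prolonged field maps the equation \<open>H\<close> to
  \<open>(c - 2 \<psi>) H\<close> plus \<open>g\<^sup>i\<^sup>j (2 c\<^sub>,\<^sub>j - (2 - n) \<psi>\<^sub>,\<^sub>j) p\<^sub>i\<close> plus a function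
  of \<open>(x, u)\<close>. Both extra terms must vanish, and their vanishing suffices. The first one makes
  \<open>c - (2 - n) \<psi> / 2\<close> a constant on the connected set \<open>U\<close>, the constant \<open>a\<^sub>0\<close>; the second one is
  the displayed condition on \<open>f\<close> and \<open>b\<close>. The case \<open>n = 2\<close> is the same formula with
  vanishing coefficient \<open>2 - n\<close>.
\<close>

section \<open>Calculus of smooth functions on open sets\<close>

lemma frechet_derivative_eqI:
  "(F has_derivative F') (at x) \<Longrightarrow> frechet_derivative F (at x) = F'"
  using frechet_derivative_at by metis

text \<open>
  The predicate is evaluated through derivatives at points of \<open>S\<close>, which for open \<open>S\<close> see only the
  values on \<open>S\<close>.
\<close>

lemma Ck_on_cong:
  assumes "open S" "\<And>x. x \<in> S \<Longrightarrow> F x = G x"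
  shows "Ck_on k S F \<longleftrightarrow> Ck_on k S G"
  using assms(2)
proof (induction k arbitrary: F G)
  case 0
  then show ?case by (auto cong: continuous_on_cong)
next
  case (Suc k)
  have d: "F differentiable (at x) \<longleftrightarrow> G differentiable (at x)" if "x \<in> S" for x
    using Suc.prems assms(1) that
    by (metis differentiable_def has_derivative_transform_within_open)
  have "Ck_on k S (\<lambda>x. frechet_derivative F (at x) v) \<longleftrightarrow> Ck_on k S (\<lambda>x. frechet_derivative G (at x) v)"
    if "\<forall>x\<in>S. F differentiable (at x)" for v
    by (rule Suc.IH) (use Suc.prems assms(1) that frechet_derivative_transform_within_open[of F _ S G] in auto)
  then show ?case
    using d by auto
qed

text \<open>
  Any formula for the derivative on \<open>S\<close> may be used to verify smoothness. The closure
  properties below all have this form: differentiate by rule, then apply the induction hypothesis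
  to the resulting expression.
\<close>

lemma Ck_on_SucI:
  assumes "open S" "\<And>x. x \<in> S \<Longrightarrow> (F has_derivative F' x) (at x)"
    and "\<And>v. Ck_on k S (\<lambda>x. F' x v)"
  shows "Ck_on (Suc k) S F"
proof -
  have "Ck_on k S (\<lambda>x. frechet_derivative F (at x) v)" for v
    using Ck_on_cong[OF assms(1), of "\<lambda>x. frechet_derivative F (at x) v" "\<lambda>x. F' x v"]
      assms(2,3) frechet_derivative_eqI by metis
  then show ?thesis
    using assms(2) by (auto simp: differentiable_def)
qed

lemma Ck_on_has_derivative:
  "Ck_on (Suc k) S F \<Longrightarrow> x \<in> S \<Longrightarrow> (F has_derivative frechet_derivative F (at x)) (at x)"
  using frechet_derivative_works by auto

lemma Ck_on_pred: "Ck_on (Suc k) S F \<Longrightarrow> Ck_on k S F"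
proof (induction k arbitrary: F)
  case 0
  then show ?case
    by (auto intro!: continuous_at_imp_continuous_on differentiable_imp_continuous_within)
qed auto

lemma Ck_on_const: "Ck_on k S (\<lambda>x. c)"
  by (induction k arbitrary: c) auto

lemma Ck_on_add:
  "open S \<Longrightarrow> Ck_on k S F \<Longrightarrow> Ck_on k S G \<Longrightarrow> Ck_on k S (\<lambda>x. F x + G x)"
proof (induction k arbitrary: F G)
  case 0
  then show ?case by (auto intro!: continuous_intros)
next
  case (Suc k)
  show ?case
  proof (rule Ck_on_SucI[OF Suc.prems(1)])
    show "((\<lambda>x. F x + G x) has_derivative
        (\<lambda>v. frechet_derivative F (at x) v + frechet_derivative G (at x) v)) (at x)" if "x \<in> S" for x
      by (intro has_derivative_add Ck_on_has_derivative[OF Suc.prems(2) that]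
          Ck_on_has_derivative[OF Suc.prems(3) that])
  qed (use Suc in auto)
qed

lemma Ck_on_bounded_linear:
  assumes "bounded_linear L"
  shows "open S \<Longrightarrow> Ck_on k S F \<Longrightarrow> Ck_on k S (\<lambda>x. L (F x))"
proof (induction k arbitrary: F)
  case 0
  then show ?case
    using bounded_linear.continuous_on[OF assms] by auto
next
  case (Suc k)
  show ?case
  proof (rule Ck_on_SucI[OF Suc.prems(1)])
    show "((\<lambda>x. L (F x)) has_derivative (\<lambda>v. L (frechet_derivative F (at x) v))) (at x)"
      if "x \<in> S" for x
      by (intro bounded_linear.has_derivative[OF assms] Ck_on_has_derivative[OF Suc.prems(2) that])
  qed (use Suc in auto)
qed

lemma Ck_on_mult:
  fixes F G :: "'a::euclidean_space \<Rightarrow> real"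
  shows "open S \<Longrightarrow> Ck_on k S F \<Longrightarrow> Ck_on k S G \<Longrightarrow> Ck_on k S (\<lambda>x. F x * G x)"
proof (induction k arbitrary: F G)
  case 0
  then show ?case by (auto intro!: continuous_intros)
next
  case (Suc k)
  show ?case
  proof (rule Ck_on_SucI[OF Suc.prems(1)])
    show "((\<lambda>x. F x * G x) has_derivative
        (\<lambda>v. F x * frechet_derivative G (at x) v + frechet_derivative F (at x) v * G x)) (at x)"
      if "x \<in> S" for x
      by (intro has_derivative_mult Ck_on_has_derivative[OF Suc.prems(2) that]
          Ck_on_has_derivative[OF Suc.prems(3) that])
    show "Ck_on k S (\<lambda>x. F x * frechet_derivative G (at x) v + frechet_derivative F (at x) v * G x)" for v
      using Suc.prems Ck_on_pred by (intro Ck_on_add Suc.IH) auto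
  qed
qed

lemma Ck_on_inverse:
  fixes F :: "'a::euclidean_space \<Rightarrow> real"
  assumes "open S" "\<And>x. x \<in> S \<Longrightarrow> F x \<noteq> 0"
  shows "Ck_on k S F \<Longrightarrow> Ck_on k S (\<lambda>x. inverse (F x))"
proof (induction k)
  case 0
  then show ?case using assms by (auto intro!: continuous_intros)
next
  case (Suc k)
  have IH: "Ck_on k S (\<lambda>x. inverse (F x))"
    using Suc.IH Suc.prems Ck_on_pred by blast
  show ?case
  proof (rule Ck_on_SucI[OF assms(1)])
    show "((\<lambda>x. inverse (F x)) has_derivative
        (\<lambda>v. - 1 * (inverse (F x) * frechet_derivative F (at x) v * inverse (F x)))) (at x)"
      if "x \<in> S" for x
      using Deriv.has_derivative_inverse[OF assms(2)[OF that] Ck_on_has_derivative[OF Suc.prems that]] by simp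
    show "Ck_on k S (\<lambda>x. - 1 * (inverse (F x) * frechet_derivative F (at x) v * inverse (F x)))" for v
      using Suc.prems IH by (intro Ck_on_mult Ck_on_const assms(1)) auto
  qed
qed

lemma Ck_on_slice:
  fixes F :: "'a::euclidean_space \<times> 'c::euclidean_space \<Rightarrow> 'b::real_normed_vector"
  assumes "open U" "u \<in> J"
  shows "Ck_on k (U \<times> J) F \<Longrightarrow> Ck_on k U (\<lambda>x. F (x, u))"
proof (induction k arbitrary: F)
  case 0
  show ?case
    unfolding Ck_on.simps
    by (rule continuous_on_compose2[OF 0[unfolded Ck_on.simps]]) (use assms in \<open>auto intro!: continuous_intros\<close>)
next
  case (Suc k)
  show ?case
  proof (rule Ck_on_SucI[OF assms(1)])
    show "((\<lambda>x. F (x, u)) has_derivative (\<lambda>v. frechet_derivative F (at (x, u)) (v, 0))) (at x)"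
      if "x \<in> U" for x
    proof (rule has_derivative_compose[of "\<lambda>x. (x, u)" "\<lambda>v. (v, 0)"])
      show "(F has_derivative frechet_derivative F (at (x, u))) (at (x, u))"
        using Ck_on_has_derivative[OF Suc.prems] that assms(2) by blast
    qed (auto intro!: derivative_eq_intros)
    show "Ck_on k U (\<lambda>x. frechet_derivative F (at (x, u)) (v, 0))" for v
      using Suc.IH[of "\<lambda>z. frechet_derivative F (at z) (v, 0)"] Suc.prems by simp
  qed
qed

lemma smooth_on_cong: "open S \<Longrightarrow> (\<And>x. x \<in> S \<Longrightarrow> F x = G x) \<Longrightarrow> smooth_on S F \<longleftrightarrow> smooth_on S G"
  unfolding smooth_on_def using Ck_on_cong by metis

lemma smooth_on_has_derivative:
  "smooth_on S F \<Longrightarrow> x \<in> S \<Longrightarrow> (F has_derivative frechet_derivative F (at x)) (at x)"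
  unfolding smooth_on_def using Ck_on_has_derivative by blast

lemma smooth_on_differentiable: "smooth_on S F \<Longrightarrow> x \<in> S \<Longrightarrow> F differentiable (at x)"
  using smooth_on_has_derivative differentiable_def by blast

lemma smooth_on_continuous_on: "smooth_on S F \<Longrightarrow> continuous_on S F"
  unfolding smooth_on_def by (metis Ck_on.simps(1))

lemma smooth_on_frechet_derivative:
  "smooth_on S F \<Longrightarrow> smooth_on S (\<lambda>x. frechet_derivative F (at x) v)"
  unfolding smooth_on_def by (metis Ck_on.simps(2))

lemma smooth_on_const: "smooth_on S (\<lambda>x. c)"
  unfolding smooth_on_def by (simp add: Ck_on_const)

lemma smooth_on_add: "open S \<Longrightarrow> smooth_on S F \<Longrightarrow> smooth_on S G \<Longrightarrow> smooth_on S (\<lambda>x. F x + G x)"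
  unfolding smooth_on_def by (simp add: Ck_on_add)

lemma smooth_on_bounded_linear:
  "bounded_linear L \<Longrightarrow> open S \<Longrightarrow> smooth_on S F \<Longrightarrow> smooth_on S (\<lambda>x. L (F x))"
  unfolding smooth_on_def by (simp add: Ck_on_bounded_linear)

lemma smooth_on_nth:
  "open S \<Longrightarrow> smooth_on S F \<Longrightarrow> smooth_on S (\<lambda>x. F x $ i)"
  by (rule smooth_on_bounded_linear[OF bounded_linear_vec_nth])

lemma smooth_on_mult:
  fixes F G :: "'a::euclidean_space \<Rightarrow> real"
  shows "open S \<Longrightarrow> smooth_on S F \<Longrightarrow> smooth_on S G \<Longrightarrow> smooth_on S (\<lambda>x. F x * G x)"
  unfolding smooth_on_def by (simp add: Ck_on_mult)

lemma smooth_on_diff: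
  fixes F G :: "'a::euclidean_space \<Rightarrow> real"
  assumes "open S" "smooth_on S F" "smooth_on S G"
  shows "smooth_on S (\<lambda>x. F x - G x)"
  using smooth_on_add[OF assms(1,2) smooth_on_mult[OF assms(1) smooth_on_const[of S "-1"] assms(3)]]
  by simp

lemma smooth_on_divide:
  fixes F G :: "'a::euclidean_space \<Rightarrow> real"
  assumes "open S" "smooth_on S F" "smooth_on S G" "\<And>x. x \<in> S \<Longrightarrow> G x \<noteq> 0"
  shows "smooth_on S (\<lambda>x. F x / G x)"
proof -
  have "smooth_on S (\<lambda>x. inverse (G x))"
    using assms unfolding smooth_on_def by (simp add: Ck_on_inverse)
  from smooth_on_mult[OF assms(1,2) this] show ?thesis
    by (simp add: divide_inverse)
qed

lemma smooth_on_sum: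
  assumes "open S" "finite I" "\<And>i. i \<in> I \<Longrightarrow> smooth_on S (F i)"
  shows "smooth_on S (\<lambda>x. \<Sum>i\<in>I. F i x)"
  using assms(2,3) by (induction rule: finite_induct) (auto intro: smooth_on_const smooth_on_add assms(1))

lemma smooth_on_prod:
  fixes F :: "'i \<Rightarrow> 'a::euclidean_space \<Rightarrow> real"
  assumes "open S" "finite I" "\<And>i. i \<in> I \<Longrightarrow> smooth_on S (F i)"
  shows "smooth_on S (\<lambda>x. \<Prod>i\<in>I. F i x)"
  using assms(2,3) by (induction rule: finite_induct) (auto intro: smooth_on_const smooth_on_mult assms(1))

lemma smooth_on_slice:
  "open U \<Longrightarrow> u \<in> J \<Longrightarrow> smooth_on (U \<times> J) F \<Longrightarrow> smooth_on U (\<lambda>x. F (x, u))"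
  unfolding smooth_on_def by (simp add: Ck_on_slice)

lemma smooth_on_pd: "smooth_on U F \<Longrightarrow> smooth_on U (pd i F)"
  unfolding pd_def by (rule smooth_on_frechet_derivative)

lemmas smooth_intros = smooth_on_const smooth_on_add smooth_on_diff smooth_on_mult smooth_on_sum
  smooth_on_divide smooth_on_pd smooth_on_nth

text \<open>
  By two applications of the mean value theorem the second difference is \<open>h\<^sup>2\<close> times a value of the
  iterated derivative near \<open>x\<close>. As it is symmetric in \<open>v\<close> and \<open>w\<close>, it compares the two orders of
  differentiation.
\<close>

lemma second_difference_mean_value:
  fixes F :: "'a::euclidean_space \<Rightarrow> real"
  assumes S: "open S" "smooth_on S F" and "ball x r \<subseteq> S" and h: "0 < h" "h * (norm v + norm w) < r"
  shows "\<exists>y\<in>ball x r. F (x + h *\<^sub>R v + h *\<^sub>R w) - F (x + h *\<^sub>R v) - F (x + h *\<^sub>R w) + F x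
      = h * h * frechet_derivative (\<lambda>y. frechet_derivative F (at y) v) (at y) w"
proof -
  have mem: "x + s *\<^sub>R v + t *\<^sub>R w \<in> ball x r" if "0 \<le> s" "s \<le> h" "0 \<le> t" "t \<le> h" for s t
  proof -
    have "norm (s *\<^sub>R v + t *\<^sub>R w) \<le> s * norm v + t * norm w"
      using norm_triangle_ineq[of "s *\<^sub>R v" "t *\<^sub>R w"] that by simp
    also have "\<dots> \<le> h * norm v + h * norm w"
      by (intro add_mono mult_right_mono) (use that in auto)
    also have "\<dots> < r" using h by (simp add: algebra_simps)
    finally show ?thesis
      using norm_minus_commute[of x "x + s *\<^sub>R v + t *\<^sub>R w"] by (simp add: dist_norm algebra_simps)
  qed
  have D: "((\<lambda>s. F (x + s *\<^sub>R v + t *\<^sub>R w)) has_real_derivative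
      frechet_derivative F (at (x + s *\<^sub>R v + t *\<^sub>R w)) v) (at s)"
    if "0 \<le> s" "s \<le> h" "0 \<le> t" "t \<le> h" for s t
  proof -
    have d: "(F has_derivative frechet_derivative F (at (x + s *\<^sub>R v + t *\<^sub>R w))) (at (x + s *\<^sub>R v + t *\<^sub>R w))"
      using smooth_on_has_derivative[OF S(2)] mem[OF that] assms(3) by auto
    have "((\<lambda>s. F (x + s *\<^sub>R v + t *\<^sub>R w)) has_derivative
      (\<lambda>h. frechet_derivative F (at (x + s *\<^sub>R v + t *\<^sub>R w)) (h *\<^sub>R v))) (at s)"
      by (rule has_derivative_compose[where f = "\<lambda>s. x + s *\<^sub>R v + t *\<^sub>R w" and g = F, OF _ d]) (auto intro!: derivative_eq_intros)
    moreover have "frechet_derivative F (at (x + s *\<^sub>R v + t *\<^sub>R w)) (h *\<^sub>R v) =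
        h *\<^sub>R frechet_derivative F (at (x + s *\<^sub>R v + t *\<^sub>R w)) v" for h
      using linear_scale[OF has_derivative_linear[OF d]] .
    ultimately show ?thesis
      by (simp add: has_field_derivative_def mult_commute_abs)
  qed
  have D2: "((\<lambda>t. frechet_derivative F (at (x + s *\<^sub>R v + t *\<^sub>R w)) v) has_real_derivative
      frechet_derivative (\<lambda>y. frechet_derivative F (at y) v) (at (x + s *\<^sub>R v + t *\<^sub>R w)) w) (at t)"
    if "0 \<le> s" "s \<le> h" "0 \<le> t" "t \<le> h" for s t
  proof -
    let ?G = "\<lambda>y. frechet_derivative F (at y) v"
    have d: "(?G has_derivative frechet_derivative ?G (at (x + s *\<^sub>R v + t *\<^sub>R w))) (at (x + s *\<^sub>R v + t *\<^sub>R w))"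
      using smooth_on_has_derivative[OF smooth_on_frechet_derivative[OF S(2)]] mem[OF that] assms(3) by auto
    have "((\<lambda>t. ?G (x + s *\<^sub>R v + t *\<^sub>R w)) has_derivative
      (\<lambda>h. frechet_derivative ?G (at (x + s *\<^sub>R v + t *\<^sub>R w)) (h *\<^sub>R w))) (at t)"
      by (rule has_derivative_compose[where f = "\<lambda>t. x + s *\<^sub>R v + t *\<^sub>R w" and g = ?G, OF _ d]) (auto intro!: derivative_eq_intros)
    moreover have "frechet_derivative ?G (at (x + s *\<^sub>R v + t *\<^sub>R w)) (h *\<^sub>R w) =
        h *\<^sub>R frechet_derivative ?G (at (x + s *\<^sub>R v + t *\<^sub>R w)) w" for h
      using linear_scale[OF has_derivative_linear[OF d]] .
    ultimately show ?thesis
      by (simp add: has_field_derivative_def mult_commute_abs)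
  qed
  have "\<exists>s>0. s < h \<and> (F (x + h *\<^sub>R v + h *\<^sub>R w) - F (x + h *\<^sub>R v + 0 *\<^sub>R w)) - (F (x + 0 *\<^sub>R v + h *\<^sub>R w) - F (x + 0 *\<^sub>R v + 0 *\<^sub>R w))
      = (h - 0) * (frechet_derivative F (at (x + s *\<^sub>R v + h *\<^sub>R w)) v - frechet_derivative F (at (x + s *\<^sub>R v + 0 *\<^sub>R w)) v)"
    by (rule MVT2[OF h(1)], intro DERIV_diff D) (use h in auto)
  then obtain s where s: "0 < s" "s < h" and e1: "(F (x + h *\<^sub>R v + h *\<^sub>R w) - F (x + h *\<^sub>R v + 0 *\<^sub>R w)) - (F (x + 0 *\<^sub>R v + h *\<^sub>R w) - F (x + 0 *\<^sub>R v + 0 *\<^sub>R w))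
      = (h - 0) * (frechet_derivative F (at (x + s *\<^sub>R v + h *\<^sub>R w)) v - frechet_derivative F (at (x + s *\<^sub>R v + 0 *\<^sub>R w)) v)"
    by blast
  have "\<exists>t>0. t < h \<and> frechet_derivative F (at (x + s *\<^sub>R v + h *\<^sub>R w)) v - frechet_derivative F (at (x + s *\<^sub>R v + 0 *\<^sub>R w)) v
    = (h - 0) * frechet_derivative (\<lambda>y. frechet_derivative F (at y) v) (at (x + s *\<^sub>R v + t *\<^sub>R w)) w"
    by (rule MVT2[OF h(1)], intro D2) (use s in auto)
  then obtain t where t: "0 < t" "t < h" and e2: "frechet_derivative F (at (x + s *\<^sub>R v + h *\<^sub>R w)) v - frechet_derivative F (at (x + s *\<^sub>R v + 0 *\<^sub>R w)) v
    = (h - 0) * frechet_derivative (\<lambda>y. frechet_derivative F (at y) v) (at (x + s *\<^sub>R v + t *\<^sub>R w)) w"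
    by blast
  show ?thesis
    using e1[unfolded e2] mem[of s t] s t by (intro bexI[of _ "x + s *\<^sub>R v + t *\<^sub>R w"]) auto
qed

text \<open>
  Both iterated derivatives take a common value at points arbitrarily close to \<open>x\<close>, so by
  continuity they agree at \<open>x\<close>.
\<close>

lemma frechet_derivative_commute:
  fixes F :: "'a::euclidean_space \<Rightarrow> real"
  assumes S: "open S" "smooth_on S F" and x: "x \<in> S"
  shows "frechet_derivative (\<lambda>y. frechet_derivative F (at y) v) (at x) w
       = frechet_derivative (\<lambda>y. frechet_derivative F (at y) w) (at x) v" (is "?G x = ?K x")
proof (rule ccontr)
  assume ne: "?G x \<noteq> ?K x"
  define e where "e = \<bar>?G x - ?K x\<bar> / 2"
  have e: "e > 0" using ne by (simp add: e_def)
  have sm: "smooth_on S ?G" "smooth_on S ?K"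
    using S(2) by (auto intro!: smooth_on_frechet_derivative)
  have c: "isCont ?G x" "isCont ?K x"
    using smooth_on_continuous_on[OF sm(1)] smooth_on_continuous_on[OF sm(2)] S(1) x
    by (auto simp: continuous_on_eq_continuous_at)
  obtain r1 where r1: "r1 > 0" "\<And>y. dist y x < r1 \<Longrightarrow> dist (?G y) (?G x) < e"
    using c(1) e unfolding continuous_at_eps_delta by meson
  obtain r2 where r2: "r2 > 0" "\<And>y. dist y x < r2 \<Longrightarrow> dist (?K y) (?K x) < e"
    using c(2) e unfolding continuous_at_eps_delta by meson
  obtain r3 where r3: "r3 > 0" "ball x r3 \<subseteq> S"
    using S(1) x open_contains_ball by blast
  define r where "r = min r1 (min r2 r3)"
  have r: "r > 0" "ball x r \<subseteq> S" using r1 r2 r3 by (auto simp: r_def)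
  \<comment> \<open>The summand 1 keeps the denominator positive when both directions vanish.\<close>
  define h where "h = r / (norm v + norm w + 1)"
  have pos: "norm v + norm w + 1 > 0"
    using norm_ge_zero[of v] norm_ge_zero[of w] by linarith
  have h: "h > 0" "h * (norm v + norm w) < r"
    using r pos by (auto simp: h_def field_simps)
  obtain y where y: "y \<in> ball x r" and ey: "F (x + h *\<^sub>R v + h *\<^sub>R w) - F (x + h *\<^sub>R v) - F (x + h *\<^sub>R w) + F x
      = h * h * ?G y"
    using second_difference_mean_value[OF S r(2) h] by blast
  have h': "h * (norm w + norm v) < r" using h(2) by (simp add: add.commute)
  obtain z where z: "z \<in> ball x r" and ez: "F (x + h *\<^sub>R w + h *\<^sub>R v) - F (x + h *\<^sub>R w) - F (x + h *\<^sub>R v) + F x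
      = h * h * ?K z"
    using second_difference_mean_value[OF S r(2) h(1) h'] by blast
  have "x + h *\<^sub>R w + h *\<^sub>R v = x + h *\<^sub>R v + h *\<^sub>R w" by simp
  note ez' = ez[unfolded this]
  have "h * h * ?G y = h * h * ?K z"
    unfolding ey[symmetric] ez'[symmetric] by simp
  then have "?G y = ?K z" using h(1) by simp
  moreover have "\<bar>?G y - ?G x\<bar> < e" "\<bar>?K z - ?K x\<bar> < e"
    using r1(2)[of y] r2(2)[of z] y z by (auto simp: r_def dist_real_def dist_commute)
  moreover have False if "a = c" "\<bar>a - b\<bar> < \<bar>b - d\<bar> / 2" "\<bar>c - d\<bar> < \<bar>b - d\<bar> / 2" for a b c d :: real
    using that by (auto simp: abs_if split: if_splits)
  ultimately show False
    unfolding e_def by blast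
qed

lemma pd_commute:
  "open U \<Longrightarrow> smooth_on U F \<Longrightarrow> x \<in> U \<Longrightarrow> pd j (pd i F) x = pd i (pd j F) x"
  unfolding pd_def by (rule frechet_derivative_commute)

section \<open>Partial derivatives and the inverse metric\<close>

lemma pd_const [simp]: "pd i (\<lambda>y. c) x = 0"
  by (simp add: pd_def)

lemma pd_cong:
  assumes "open U" "x \<in> U" "F differentiable (at x)" "\<And>y. y \<in> U \<Longrightarrow> F y = G y"
  shows "pd i F x = pd i G x"
  unfolding pd_def using frechet_derivative_transform_within_open[OF assms(3,1,2,4)] by simp

lemma pd_add:
  "smooth_on U F \<Longrightarrow> smooth_on U G \<Longrightarrow> x \<in> U \<Longrightarrow> pd i (\<lambda>y. F y + G y) x = pd i F x + pd i G x"
  unfolding pd_def by (subst frechet_derivative_eqI[OF has_derivative_add]) (auto intro: smooth_on_has_derivative)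

lemma pd_diff:
  "smooth_on U F \<Longrightarrow> smooth_on U G \<Longrightarrow> x \<in> U \<Longrightarrow> pd i (\<lambda>y. F y - G y) x = pd i F x - pd i G x"
  unfolding pd_def by (subst frechet_derivative_eqI[OF has_derivative_diff]) (auto intro: smooth_on_has_derivative)

lemma pd_mult:
  "smooth_on U F \<Longrightarrow> smooth_on U G \<Longrightarrow> x \<in> U \<Longrightarrow>
    pd i (\<lambda>y. F y * G y) x = F x * pd i G x + pd i F x * G x"
  unfolding pd_def by (subst frechet_derivative_eqI[OF has_derivative_mult]) (auto intro: smooth_on_has_derivative)

lemma pd_cmult:
  "smooth_on U F \<Longrightarrow> x \<in> U \<Longrightarrow> pd i (\<lambda>y. c * F y) x = c * pd i F x"
  by (subst pd_mult[of U]) (auto simp: smooth_on_const)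

lemma pd_sum:
  "(\<And>j. j \<in> I \<Longrightarrow> smooth_on U (F j)) \<Longrightarrow> x \<in> U \<Longrightarrow>
    pd i (\<lambda>y. \<Sum>j\<in>I. F j y) x = (\<Sum>j\<in>I. pd i (F j) x)"
  unfolding pd_def by (subst frechet_derivative_eqI[OF has_derivative_sum]) (auto intro: smooth_on_has_derivative)

lemma frechet_derivative_eq_sum_pd:
  assumes "F differentiable (at x)"
  shows "frechet_derivative F (at x) v = (\<Sum>i\<in>UNIV. v $ i * pd i F x)"
proof -
  have l: "linear (frechet_derivative F (at x))"
    using assms has_derivative_linear frechet_derivative_works by blast
  have "frechet_derivative F (at x) v = frechet_derivative F (at x) (\<Sum>i\<in>UNIV. v $ i *\<^sub>R axis i 1)"
    using basis_expansion[of v] by (simp add: scalar_mult_eq_scaleR)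
  also have "\<dots> = (\<Sum>i\<in>UNIV. v $ i * pd i F x)"
    by (simp add: linear_sum[OF l] linear_scale[OF l] pd_def)
  finally show ?thesis .
qed

lemma smooth_on_det:
  fixes M :: "'a::euclidean_space \<Rightarrow> real^'n^'n"
  assumes "open S" "\<And>i j. smooth_on S (\<lambda>x. M x $ i $ j)"
  shows "smooth_on S (\<lambda>x. det (M x))"
  unfolding det_def
  by (intro smooth_on_sum smooth_on_mult smooth_on_const smooth_on_prod assms) (auto simp: finite_permutations)

lemma matrix_inv_mult:
  fixes A :: "real^'n^'n"
  assumes "det A \<noteq> 0"
  shows "A ** matrix_inv A = mat 1" "matrix_inv A ** A = mat 1"
proof -
  have "\<exists>B. A ** B = mat 1 \<and> B ** A = mat 1"
    using assms invertible_det_nz[of A] unfolding invertible_def by blast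
  then have "A ** matrix_inv A = mat 1 \<and> matrix_inv A ** A = mat 1"
    unfolding matrix_inv_def by (rule someI_ex)
  then show "A ** matrix_inv A = mat 1" "matrix_inv A ** A = mat 1" by auto
qed

text \<open>
  Cramer's rule exhibits the entries of the inverse as rational functions of those of \<open>A\<close>, which is what
  makes the inverse metric smooth.
\<close>

lemma matrix_inv_cramer:
  fixes A :: "real^'n^'n"
  assumes "det A \<noteq> 0"
  shows "matrix_inv A $ i $ j = det (\<chi> k l. if l = i then axis j 1 $ k else A $ k $ l) / det A"
proof -
  have "A *v (matrix_inv A *v axis j 1) = axis j 1"
    by (simp add: matrix_vector_mul_assoc matrix_inv_mult[OF assms])
  then have "matrix_inv A *v axis j 1 = (\<chi> i. det (\<chi> k l. if l = i then axis j 1 $ k else A $ k $ l) / det A)"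
    using cramer[OF assms] by blast
  then show ?thesis
    by (simp add: vec_eq_iff matrix_vector_mult_basis column_def)
qed

lemma matrix_mult_diff_distrib:
  fixes A :: "real^'n^'m"
  shows "A ** (B - C) = A ** B - A ** C" "(D - E) ** F = D ** F - E ** (F :: real^'n^'m)"
    "(D + E) ** F = D ** F + E ** F"
  by (simp_all add: vec_eq_iff matrix_matrix_mult_def sum_subtractf sum.distrib algebra_simps)

lemma matrix_mult_minus:
  fixes A :: "real^'n^'m"
  shows "A ** (- B) = - (A ** B)" "(- A) ** C = - (A ** C)"
  by (simp_all add: vec_eq_iff matrix_matrix_mult_def sum_negf)

text \<open>
  Here \<open>dA\<close> and \<open>dB\<close> stand for the derivatives of a metric and its inverse along a field with Jacobian
  \<open>N\<close>. Since \<open>dB = - B dA B\<close>, the Lie derivative of the inverse is obtained from that of the metric by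
  multiplying with \<open>- B\<close> on both sides, which turns \<open>c A\<close> into \<open>- c B\<close>.
\<close>

lemma lie_derivative_inverse_iff:
  fixes A B N dA dB :: "real^'n^'n"
  assumes inv: "A ** B = mat 1" "B ** A = mat 1" and d: "A ** dB + dA ** B = 0"
  shows "dA + N ** A + A ** transpose N = c *\<^sub>R A \<longleftrightarrow>
         dB - B ** N - transpose N ** B = - c *\<^sub>R B"
proof -
  have simps: "X ** A ** B = X" "X ** B ** A = X" for X :: "real^'n^'n"
    by (simp_all add: matrix_mul_assoc[symmetric] inv)
  have dB: "dB = - (B ** dA ** B)"
  proof -
    have "A ** dB = - (dA ** B)" using d by (simp add: eq_neg_iff_add_eq_0)
    then have "B ** (A ** dB) = B ** (- (dA ** B))" by simp
    then show ?thesis by (simp add: matrix_mul_assoc inv matrix_mult_minus)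
  qed
  have dA: "dA = - (A ** dB ** A)"
    by (simp add: dB matrix_mult_minus matrix_mul_assoc inv simps)
  show ?thesis
  proof
    assume "dA + N ** A + A ** transpose N = c *\<^sub>R A"
    then have *: "dA = c *\<^sub>R A - N ** A - A ** transpose N" by (simp add: algebra_simps)
    have "dB = - c *\<^sub>R B + B ** N + transpose N ** B"
      unfolding dB *
      by (simp add: matrix_mult_diff_distrib matrix_mul_assoc inv simps matrix_scalar_ac scalar_matrix_assoc[symmetric])
    then show "dB - B ** N - transpose N ** B = - c *\<^sub>R B" by simp
  next
    assume "dB - B ** N - transpose N ** B = - c *\<^sub>R B"
    then have *: "dB = B ** N + transpose N ** B - c *\<^sub>R B" by (simp add: algebra_simps)
    have "dA = c *\<^sub>R A - N ** A - A ** transpose N"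
      unfolding dA *
      by (simp add: matrix_mult_diff_distrib matrix_add_ldistrib matrix_mul_assoc inv simps
          matrix_scalar_ac scalar_matrix_assoc[symmetric])
    then show "dA + N ** A + A ** transpose N = c *\<^sub>R A" by simp
  qed
qed

locale coordinate_metric =
  fixes U :: "(real^'n::finite) set" and g :: "real^'n \<Rightarrow> real^'n^'n"
  assumes open_U: "open U" and metric: "metric_on U g"
begin

lemma smooth_metric: "smooth_on U (\<lambda>x. g x $ i $ j)"
  using metric by (auto simp: metric_on_def intro!: smooth_on_nth open_U)

lemma metric_commute: "x \<in> U \<Longrightarrow> g x $ i $ j = g x $ j $ i"
  using metric unfolding metric_on_def transpose_def vec_eq_iff by auto

lemma det_metric: "x \<in> U \<Longrightarrow> det (g x) \<noteq> 0"
  using metric by (auto simp: metric_on_def)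

lemma smooth_ginv: "smooth_on U (\<lambda>x. ginv g x i j)"
proof -
  have "smooth_on U (\<lambda>x. if l = i then axis j 1 $ k else g x $ k $ l)" for k l
    by (cases "l = i") (simp_all add: smooth_on_const smooth_metric)
  then have "smooth_on U (\<lambda>x. det (\<chi> k l. if l = i then axis j 1 $ k else g x $ k $ l) / det (g x))"
    by (intro smooth_on_divide smooth_on_det det_metric smooth_metric open_U) simp_all
  then show ?thesis
    unfolding ginv_def
    by (subst smooth_on_cong[OF open_U matrix_inv_cramer[OF det_metric]]) auto
qed

lemma metric_ginv: "x \<in> U \<Longrightarrow> (\<Sum>k\<in>UNIV. g x $ i $ k * ginv g x k j) = (if i = j then 1 else 0)"
  using arg_cong[OF matrix_inv_mult(1)[OF det_metric], of x "\<lambda>M. M $ i $ j"]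
  by (simp add: matrix_matrix_mult_def mat_def ginv_def)

lemma ginv_metric: "x \<in> U \<Longrightarrow> (\<Sum>k\<in>UNIV. ginv g x i k * g x $ k $ j) = (if i = j then 1 else 0)"
  using arg_cong[OF matrix_inv_mult(2)[OF det_metric], of x "\<lambda>M. M $ i $ j"]
  by (simp add: matrix_matrix_mult_def mat_def ginv_def)

lemma ginv_commute: "x \<in> U \<Longrightarrow> ginv g x i j = ginv g x j i"
proof -
  assume x: "x \<in> U"
  have s: "transpose (g x) = g x" using metric x by (simp add: metric_on_def)
  let ?B = "matrix_inv (g x)"
  have "transpose (g x ** ?B) = mat 1" by (simp add: matrix_inv_mult[OF det_metric[OF x]])
  then have "transpose ?B ** g x = mat 1" by (simp add: matrix_transpose_mul s)
  then have "transpose ?B ** g x ** ?B = ?B" by simp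
  then have "transpose ?B = ?B"
    by (simp add: matrix_mul_assoc[symmetric] matrix_inv_mult[OF det_metric[OF x]])
  then show ?thesis unfolding ginv_def transpose_def vec_eq_iff by auto
qed

lemma ginv_metric_contract:
  assumes "x \<in> U"
  shows "(\<Sum>i\<in>UNIV. \<Sum>j\<in>UNIV. ginv g x i j * g x $ i $ j) = real CARD('n)"
  using ginv_metric[OF assms] by (simp add: metric_commute[OF assms])

lemma smooth_christoffel: "smooth_on U (christoffel g i j k)"
  unfolding christoffel_def[abs_def]
  by (intro smooth_intros smooth_ginv smooth_metric open_U) auto

lemma smooth_contracted_christoffel: "smooth_on U (contracted_christoffel g i)"
  unfolding contracted_christoffel_def[abs_def]
  by (intro smooth_intros smooth_ginv smooth_christoffel open_U) auto

text \<open>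
  The prolongation produces the Lie derivative of the inverse metric, the definition of a conformal
  Killing vector that of the metric; this lemma translates between them. It is pointwise, so that a conformal factor
  can be read off at each point before anything is known about its smoothness.
\<close>

lemma conformal_killing_iff_raised:
  assumes x: "x \<in> U"
  shows "(\<forall>i j. lie_deriv_metric \<zeta> g i j x = 2 * c * g x $ i $ j) \<longleftrightarrow>
    (\<forall>i j. (\<Sum>k\<in>UNIV. \<zeta> x $ k * pd k (\<lambda>y. ginv g y i j) x)
        - (\<Sum>k\<in>UNIV. ginv g x i k * pd k (\<lambda>y. \<zeta> y $ j) x)
        - (\<Sum>k\<in>UNIV. ginv g x j k * pd k (\<lambda>y. \<zeta> y $ i) x) = - 2 * c * ginv g x i j)"
proof -
  define dA where "dA = (\<chi> i j. \<Sum>k\<in>UNIV. \<zeta> x $ k * pd k (\<lambda>y. g y $ i $ j) x)"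
  define dB where "dB = (\<chi> i j. \<Sum>k\<in>UNIV. \<zeta> x $ k * pd k (\<lambda>y. ginv g y i j) x)"
  define N where "N = (\<chi> i j. pd i (\<lambda>y. \<zeta> y $ j) x)"
  let ?A = "g x" and ?B = "matrix_inv (g x)"
  have d: "(\<Sum>k\<in>UNIV. g x $ i $ k * pd m (\<lambda>y. ginv g y k j) x) +
      (\<Sum>k\<in>UNIV. pd m (\<lambda>y. g y $ i $ k) x * ginv g x k j) = 0" for m i j
  proof -
    have "pd m (\<lambda>y. \<Sum>k\<in>UNIV. g y $ i $ k * ginv g y k j) x = pd m (\<lambda>y. if i = j then 1 else 0) x"
      by (rule pd_cong[OF open_U x])
        (auto intro!: smooth_on_differentiable[OF _ x] smooth_intros smooth_metric smooth_ginv open_U simp: metric_ginv)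
    moreover have "pd m (\<lambda>y. \<Sum>k\<in>UNIV. g y $ i $ k * ginv g y k j) x =
      (\<Sum>k\<in>UNIV. g x $ i $ k * pd m (\<lambda>y. ginv g y k j) x + pd m (\<lambda>y. g y $ i $ k) x * ginv g x k j)"
      by (simp add: pd_sum[of _ U] pd_mult[of U] x smooth_on_mult open_U smooth_metric smooth_ginv)
    ultimately show ?thesis by (simp add: sum.distrib)
  qed
  have "?A ** dB + dA ** ?B = 0"
  proof -
    have "(?A ** dB + dA ** ?B) $ i $ j = 0" for i j
    proof -
      have "(?A ** dB + dA ** ?B) $ i $ j = (\<Sum>k\<in>UNIV. \<Sum>m\<in>UNIV. \<zeta> x $ m * (g x $ i $ k * pd m (\<lambda>y. ginv g y k j) x +
          pd m (\<lambda>y. g y $ i $ k) x * ginv g x k j))"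
        by (simp add: matrix_matrix_mult_def dA_def dB_def ginv_def[symmetric] sum_distrib_left sum_distrib_right
            sum.distrib algebra_simps)
      also have "\<dots> = (\<Sum>m\<in>UNIV. \<zeta> x $ m * (\<Sum>k\<in>UNIV. (g x $ i $ k * pd m (\<lambda>y. ginv g y k j) x +
          pd m (\<lambda>y. g y $ i $ k) x * ginv g x k j)))"
        by (subst sum.swap) (simp add: sum_distrib_left)
      also have "\<dots> = 0" using d by (simp add: sum.distrib)
      finally show ?thesis .
    qed
    then show ?thesis by (simp add: vec_eq_iff)
  qed
  note iff = lie_derivative_inverse_iff[OF matrix_inv_mult[OF det_metric[OF x]] this, of N "2 * c"]
  have L: "(\<forall>i j. lie_deriv_metric \<zeta> g i j x = 2 * c * g x $ i $ j) \<longleftrightarrow>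
      dA + N ** ?A + ?A ** transpose N = (2 * c) *\<^sub>R ?A"
    by (simp add: vec_eq_iff lie_deriv_metric_def dA_def N_def matrix_matrix_mult_def transpose_def
        sum.distrib mult.commute)
  have R: "(\<forall>i j. (\<Sum>k\<in>UNIV. \<zeta> x $ k * pd k (\<lambda>y. ginv g y i j) x)
        - (\<Sum>k\<in>UNIV. ginv g x i k * pd k (\<lambda>y. \<zeta> y $ j) x)
        - (\<Sum>k\<in>UNIV. ginv g x j k * pd k (\<lambda>y. \<zeta> y $ i) x) = - 2 * c * ginv g x i j) \<longleftrightarrow>
      dB - ?B ** N - transpose N ** ?B = - (2 * c) *\<^sub>R ?B"
    using ginv_commute[OF x]
    by (simp add: vec_eq_iff dB_def N_def matrix_matrix_mult_def transpose_def ginv_def mult.commute)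
  show ?thesis using L R iff by blast
qed

end

section \<open>Conformal Killing vectors and the contracted Christoffel symbols\<close>

context coordinate_metric
begin

text \<open>
  Christoffel symbols of the first kind. Working with them keeps the inverse metric, and hence its
  derivatives, out of the computation until the final contraction.
\<close>

definition christoffel_lower :: "'n \<Rightarrow> 'n \<Rightarrow> 'n \<Rightarrow> real^'n \<Rightarrow> real" where
  "christoffel_lower l j k x =
     (pd k (\<lambda>y. g y $ l $ j) x + pd j (\<lambda>y. g y $ l $ k) x - pd l (\<lambda>y. g y $ j $ k) x) / 2"

definition contracted_christoffel_lower :: "'n \<Rightarrow> real^'n \<Rightarrow> real" where
  "contracted_christoffel_lower l x = (\<Sum>j\<in>UNIV. \<Sum>k\<in>UNIV. ginv g x j k * christoffel_lower l j k x)"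

lemma lower_index:
  assumes "x \<in> U"
  shows "(\<Sum>i\<in>UNIV. g x $ l $ i * (\<Sum>m\<in>UNIV. ginv g x i m * w m)) = w l"
proof -
  have "(\<Sum>i\<in>UNIV. g x $ l $ i * (\<Sum>m\<in>UNIV. ginv g x i m * w m)) =
      (\<Sum>m\<in>UNIV. (\<Sum>i\<in>UNIV. g x $ l $ i * ginv g x i m) * w m)"
    unfolding sum_distrib_left sum_distrib_right by (subst sum.swap) (simp add: mult.assoc)
  then show ?thesis using metric_ginv[OF assms] by (simp add: if_distrib[of "\<lambda>a. a * _"] cong: if_cong)
qed

lemma raise_index:
  assumes "x \<in> U"
  shows "(\<Sum>i\<in>UNIV. ginv g x l i * (\<Sum>m\<in>UNIV. g x $ i $ m * w m)) = w l"
proof -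
  have "(\<Sum>i\<in>UNIV. ginv g x l i * (\<Sum>m\<in>UNIV. g x $ i $ m * w m)) =
      (\<Sum>m\<in>UNIV. (\<Sum>i\<in>UNIV. ginv g x l i * g x $ i $ m) * w m)"
    unfolding sum_distrib_left sum_distrib_right by (subst sum.swap) (simp add: mult.assoc)
  then show ?thesis using ginv_metric[OF assms] by (simp add: if_distrib[of "\<lambda>a. a * _"] cong: if_cong)
qed

lemma christoffel_eq_raise:
  "christoffel g i j k x = (\<Sum>l\<in>UNIV. ginv g x i l * christoffel_lower l j k x)"
  by (simp add: christoffel_def christoffel_lower_def sum_divide_distrib)

lemma contracted_christoffel_lower_eq:
  assumes x: "x \<in> U"
  shows "contracted_christoffel_lower l x = (\<Sum>i\<in>UNIV. g x $ l $ i * contracted_christoffel g i x)"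
proof -
  have "contracted_christoffel g i x = (\<Sum>m\<in>UNIV. ginv g x i m * contracted_christoffel_lower m x)" for i
  proof -
    have "contracted_christoffel g i x =
       (\<Sum>j\<in>UNIV. \<Sum>k\<in>UNIV. \<Sum>m\<in>UNIV. ginv g x i m * (ginv g x j k * christoffel_lower m j k x))"
      by (simp add: contracted_christoffel_def christoffel_eq_raise sum_distrib_left mult.left_commute)
    also have "\<dots> = (\<Sum>j\<in>UNIV. \<Sum>m\<in>UNIV. \<Sum>k\<in>UNIV. ginv g x i m * (ginv g x j k * christoffel_lower m j k x))"
      by (intro sum.cong refl sum.swap)
    also have "\<dots> = (\<Sum>m\<in>UNIV. ginv g x i m * contracted_christoffel_lower m x)"
      by (subst sum.swap) (simp add: contracted_christoffel_lower_def sum_distrib_left)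
    finally show ?thesis .
  qed
  then show ?thesis by (simp add: lower_index[OF x])
qed

lemma smooth_christoffel_lower: "smooth_on U (christoffel_lower l j k)"
  unfolding christoffel_lower_def[abs_def]
  by (intro smooth_intros smooth_metric open_U) auto

lemma smooth_contracted_christoffel_lower: "smooth_on U (contracted_christoffel_lower l)"
  unfolding contracted_christoffel_lower_def[abs_def]
  by (intro smooth_intros smooth_christoffel_lower smooth_ginv open_U) auto

lemma pd_christoffel_lower:
  assumes x: "x \<in> U"
  shows "pd m (christoffel_lower l j k) x = (pd m (pd k (\<lambda>y. g y $ l $ j)) x
     + pd m (pd j (\<lambda>y. g y $ l $ k)) x - pd m (pd l (\<lambda>y. g y $ j $ k)) x) / 2"
proof -
  have "christoffel_lower l j k = (\<lambda>y. 1/2 *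
     (pd k (\<lambda>y. g y $ l $ j) y + pd j (\<lambda>y. g y $ l $ k) y - pd l (\<lambda>y. g y $ j $ k) y))"
    by (auto simp: christoffel_lower_def)
  then have "pd m (christoffel_lower l j k) x = pd m (\<lambda>y. 1/2 *
     (pd k (\<lambda>y. g y $ l $ j) y + pd j (\<lambda>y. g y $ l $ k) y - pd l (\<lambda>y. g y $ j $ k) y)) x"
    by (simp only:)
  also have "\<dots> = 1/2 * pd m (\<lambda>y.
     (pd k (\<lambda>y. g y $ l $ j) y + pd j (\<lambda>y. g y $ l $ k) y - pd l (\<lambda>y. g y $ j $ k) y)) x"
    by (rule pd_cmult[OF _ x]) (intro smooth_intros smooth_metric open_U)
  finally show ?thesis
    by (simp add: pd_add[of U] pd_diff[of U] x open_U smooth_metric smooth_on_pd smooth_on_add)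
qed

lemma pd_contracted_christoffel_lower:
  assumes x: "x \<in> U"
  shows "pd m (contracted_christoffel_lower l) x = (\<Sum>j\<in>UNIV. \<Sum>k\<in>UNIV.
      pd m (\<lambda>y. ginv g y j k) x * christoffel_lower l j k x + ginv g x j k * pd m (christoffel_lower l j k) x)"
  unfolding contracted_christoffel_lower_def[abs_def]
  by (simp add: pd_sum[of _ U] pd_mult[of U] x open_U smooth_ginv smooth_christoffel_lower
        smooth_on_sum smooth_on_mult add.commute)

lemma metric_derivative_commute:
  assumes "x \<in> U"
  shows "pd m (\<lambda>y. g y $ i $ j) x = pd m (\<lambda>y. g y $ j $ i) x"
  by (rule pd_cong[OF open_U assms])
    (auto simp: metric_commute intro: smooth_on_differentiable[OF smooth_metric assms])

lemma metric_second_derivative_commute: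
  assumes "x \<in> U"
  shows "pd k (pd m (\<lambda>y. g y $ i $ j)) x = pd k (pd m (\<lambda>y. g y $ j $ i)) x"
  by (rule pd_cong[OF open_U assms])
    (auto simp: metric_derivative_commute intro: smooth_on_differentiable[OF smooth_on_pd[OF smooth_metric] assms])

lemma christoffel_lower_commute: "x \<in> U \<Longrightarrow> christoffel_lower l j k x = christoffel_lower l k j x"
  by (simp add: christoffel_lower_def metric_derivative_commute[of x l j k])

lemma conformal_killing_derivative:
  assumes ckv: "conformal_killing U g \<zeta> \<psi>" and x: "x \<in> U"
  shows "(\<Sum>k\<in>UNIV. pd m (\<lambda>y. \<zeta> y $ k) x * pd k (\<lambda>y. g y $ i $ j) x
        + \<zeta> x $ k * pd m (pd k (\<lambda>y. g y $ i $ j)) x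
        + pd m (\<lambda>y. g y $ k $ j) x * pd i (\<lambda>y. \<zeta> y $ k) x
        + g x $ k $ j * pd m (pd i (\<lambda>y. \<zeta> y $ k)) x
        + pd m (\<lambda>y. g y $ i $ k) x * pd j (\<lambda>y. \<zeta> y $ k) x
        + g x $ i $ k * pd m (pd j (\<lambda>y. \<zeta> y $ k)) x)
     = 2 * (pd m \<psi> x * g x $ i $ j + \<psi> x * pd m (\<lambda>y. g y $ i $ j) x)" (is "?l = ?r")
proof -
  have sm: "smooth_on U \<psi>" "smooth_on U (\<lambda>y. \<zeta> y $ k)" for k
    using ckv by (auto simp: conformal_killing_def intro: smooth_on_nth open_U)
  note rules = pd_sum[of _ U] pd_mult[of U] pd_add[of U] pd_cmult[of U] x open_U smooth_metric smooth_on_pd sm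
        smooth_on_sum smooth_on_mult smooth_on_add
  have "pd m (lie_deriv_metric \<zeta> g i j) x = pd m (\<lambda>y. 2 * (\<psi> y * g y $ i $ j)) x"
  proof (rule pd_cong[OF open_U x])
    show "lie_deriv_metric \<zeta> g i j differentiable at x"
      unfolding lie_deriv_metric_def[abs_def]
      by (intro smooth_on_differentiable[OF _ x] smooth_intros smooth_metric sm open_U) auto
  qed (use ckv in \<open>auto simp: conformal_killing_def\<close>)
  moreover have "pd m (lie_deriv_metric \<zeta> g i j) x = ?l"
    unfolding lie_deriv_metric_def[abs_def] by (simp add: rules algebra_simps)
  moreover have "pd m (\<lambda>y. 2 * (\<psi> y * g y $ i $ j)) x = ?r"
    by (simp add: rules add.commute)
  ultimately show ?thesis by simp
qed

text \<open>
  The left-hand side is the Lie derivative of the Christoffel symbols of the first kind,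
  with the second derivatives of \<open>\<zeta>\<close> that make it tensorial. As in the derivation of the Christoffel
  symbols from the metric, it is half of the combination \<open>k l j\<close> plus \<open>j l k\<close> minus \<open>l j k\<close> of the
  differentiated conformal Killing equation.
\<close>

lemma lie_derivative_christoffel_lower:
  assumes ckv: "conformal_killing U g \<zeta> \<psi>" and x: "x \<in> U"
  shows "(\<Sum>m\<in>UNIV. \<zeta> x $ m * pd m (christoffel_lower l j k) x
       + pd k (\<lambda>y. \<zeta> y $ m) x * christoffel_lower l j m x
       + pd j (\<lambda>y. \<zeta> y $ m) x * christoffel_lower l m k x
       + pd l (\<lambda>y. \<zeta> y $ m) x * christoffel_lower m j k x
       + g x $ l $ m * pd j (pd k (\<lambda>y. \<zeta> y $ m)) x)
     = pd k \<psi> x * g x $ l $ j + pd j \<psi> x * g x $ l $ k - pd l \<psi> x * g x $ j $ k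
       + 2 * \<psi> x * christoffel_lower l j k x"
proof -
  define A where "A i j = g x $ i $ j" for i j
  define Z where "Z m = \<zeta> x $ m" for m
  define DZ where "DZ k m = pd k (\<lambda>y. \<zeta> y $ m) x" for k m
  define DDZ where "DDZ j k m = pd j (pd k (\<lambda>y. \<zeta> y $ m)) x" for j k m
  define DA where "DA k i j = pd k (\<lambda>y. g y $ i $ j) x" for k i j
  define DDA where "DDA m k i j = pd m (pd k (\<lambda>y. g y $ i $ j)) x" for m k i j
  have sm: "smooth_on U (\<lambda>y. \<zeta> y $ k)" for k
    using ckv by (auto simp: conformal_killing_def intro: smooth_on_nth open_U)
  have A: "A i j = A j i" for i j unfolding A_def by (rule metric_commute[OF x])
  have DA: "DA k i j = DA k j i" for k i j unfolding DA_def by (rule metric_derivative_commute[OF x])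
  have DDA: "DDA m k i j = DDA m k j i" "DDA m k i j = DDA k m i j" for m k i j
    unfolding DDA_def by (rule metric_second_derivative_commute[OF x] pd_commute[OF open_U smooth_metric x])+
  have DDZ: "DDZ j k m = DDZ k j m" for j k m
    unfolding DDZ_def by (rule pd_commute[OF open_U sm x])
  define E where "E m i j k = DZ m k * DA k i j + Z k * DDA m k i j + DA m k j * DZ i k
     + A k j * DDZ m i k + DA m i k * DZ j k + A i k * DDZ m j k" for m i j k
  have E: "(\<Sum>k\<in>UNIV. E m i j k) = 2 * (pd m \<psi> x * A i j + \<psi> x * DA m i j)" for m i j
    using conformal_killing_derivative[OF ckv x, of m i j]
    by (simp add: E_def A_def Z_def DZ_def DDZ_def DA_def DDA_def)
  have cl: "christoffel_lower l j k x = (DA k l j + DA j l k - DA l j k) / 2" for l j k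
    by (simp add: christoffel_lower_def DA_def)
  have dcl: "pd m (christoffel_lower l j k) x = (DDA m k l j + DDA m j l k - DDA m l j k) / 2" for m l j k
    by (simp add: pd_christoffel_lower[OF x] DDA_def)
  have "Z m * ((DDA m k l j + DDA m j l k - DDA m l j k) / 2)
       + DZ k m * ((DA m l j + DA j l m - DA l j m) / 2)
       + DZ j m * ((DA k l m + DA m l k - DA l m k) / 2)
       + DZ l m * ((DA k m j + DA j m k - DA m j k) / 2)
       + A l m * DDZ j k m = (E k l j m + E j l k m - E l j k m) / 2" for m
    unfolding E_def
    using A[of m l] A[of m j] A[of m k] DA[of k m l] DA[of j m l] DA[of j m k] DA[of k m j] DA[of l m j] DA[of l m k] DA[of m l j]
       DA[of m l k] DA[of m j k] DDA(2)[of k m] DDA(2)[of j m] DDA(2)[of l m] DDZ[of k l] DDZ[of j l] DDZ[of k j]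
    by (simp add: field_simps)
  then have "(\<Sum>m\<in>UNIV. Z m * ((DDA m k l j + DDA m j l k - DDA m l j k) / 2)
       + DZ k m * ((DA m l j + DA j l m - DA l j m) / 2)
       + DZ j m * ((DA k l m + DA m l k - DA l m k) / 2)
       + DZ l m * ((DA k m j + DA j m k - DA m j k) / 2)
       + A l m * DDZ j k m) = (\<Sum>m\<in>UNIV. (E k l j m + E j l k m - E l j k m) / 2)"
    by (intro sum.cong refl)
  also have "\<dots> = ((\<Sum>m\<in>UNIV. E k l j m) + (\<Sum>m\<in>UNIV. E j l k m) - (\<Sum>m\<in>UNIV. E l j k m)) / 2"
    by (simp add: sum.distrib sum_subtractf sum_divide_distrib[symmetric])
  also have "\<dots> = pd k \<psi> x * A l j + pd j \<psi> x * A l k - pd l \<psi> x * A j k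
       + 2 * \<psi> x * ((DA k l j + DA j l k - DA l j k) / 2)"
    unfolding E by (simp add: field_simps)
  finally show ?thesis
    by (simp add: cl dcl A_def[symmetric] Z_def[symmetric] DZ_def[symmetric] DDZ_def[symmetric])
qed

text \<open>
  Contraction of the previous identity with the inverse metric. The derivative of the contracted symbol
  also differentiates the inverse metric; by the conformal Killing equation in raised form this
  contributes \<open>- 2 \<psi> \<gamma>\<^sub>l\<close>, which cancels the term in \<open>\<psi>\<close> on the right, and two terms that cancel those
  with the derivative of \<open>\<zeta>\<close> in the contracted slots. The trace of the metric supplies the dimension.
\<close>

lemma lie_derivative_contracted_christoffel_lower:
  assumes ckv: "conformal_killing U g \<zeta> \<psi>" and x: "x \<in> U"
  shows "(\<Sum>m\<in>UNIV. \<zeta> x $ m * pd m (contracted_christoffel_lower l) x)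
       + (\<Sum>m\<in>UNIV. pd l (\<lambda>y. \<zeta> y $ m) x * contracted_christoffel_lower m x)
       + (\<Sum>m\<in>UNIV. g x $ l $ m * (\<Sum>j\<in>UNIV. \<Sum>k\<in>UNIV. ginv g x j k * pd j (pd k (\<lambda>y. \<zeta> y $ m)) x))
     = (2 - real CARD('n)) * pd l \<psi> x"
proof -
  define A where "A i j = g x $ i $ j" for i j
  define B where "B i j = ginv g x i j" for i j
  define Z where "Z m = \<zeta> x $ m" for m
  define DZ where "DZ k m = pd k (\<lambda>y. \<zeta> y $ m) x" for k m
  define DDZ where "DDZ j k m = pd j (pd k (\<lambda>y. \<zeta> y $ m)) x" for j k m
  define C where "C l j k = christoffel_lower l j k x" for l j k
  define DC where "DC m l j k = pd m (christoffel_lower l j k) x" for m l j k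
  define DB where "DB m i j = pd m (\<lambda>y. ginv g y i j) x" for m i j
  define dp where "dp m = pd m \<psi> x" for m
  define p where "p = \<psi> x"
  have B: "B i j = B j i" for i j unfolding B_def by (rule ginv_commute[OF x])
  have C: "C l j k = C l k j" for l j k unfolding C_def by (rule christoffel_lower_commute[OF x])
  have AB: "(\<Sum>k\<in>UNIV. A i k * B k j) = (if i = j then 1 else 0)" for i j
    using metric_ginv[OF x] by (simp add: A_def B_def)
  have raised: "(\<Sum>m\<in>UNIV. Z m * DB m j k) =
      (\<Sum>a\<in>UNIV. B j a * DZ a k) + (\<Sum>a\<in>UNIV. B k a * DZ a j) - 2 * p * B j k" for j k
  proof -
    have "\<forall>i j. lie_deriv_metric \<zeta> g i j x = 2 * \<psi> x * g x $ i $ j"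
      using ckv x by (auto simp: conformal_killing_def)
    from this[unfolded conformal_killing_iff_raised[OF x], rule_format, of j k] show ?thesis
      by (simp add: Z_def DB_def B_def DZ_def p_def algebra_simps)
  qed
  define G where "G l = (\<Sum>j\<in>UNIV. \<Sum>k\<in>UNIV. B j k * C l j k)" for l
  define T1 where "T1 = (\<Sum>j\<in>UNIV. \<Sum>k\<in>UNIV. B j k * (\<Sum>m\<in>UNIV. Z m * DC m l j k))"
  define T2 where "T2 = (\<Sum>j\<in>UNIV. \<Sum>k\<in>UNIV. B j k * (\<Sum>m\<in>UNIV. DZ k m * C l j m))"
  \<comment> \<open>By the symmetry in \<open>j\<close> and \<open>k\<close> both contracted slots contribute the same term.\<close>
  have T3: "(\<Sum>j\<in>UNIV. \<Sum>k\<in>UNIV. B j k * (\<Sum>m\<in>UNIV. DZ j m * C l m k)) = T2"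
    unfolding T2_def by (subst sum.swap) (simp add: B C)
  have T4: "(\<Sum>j\<in>UNIV. \<Sum>k\<in>UNIV. B j k * (\<Sum>m\<in>UNIV. DZ l m * C m j k)) = (\<Sum>m\<in>UNIV. DZ l m * G m)"
  proof -
    have "(\<Sum>j\<in>UNIV. \<Sum>k\<in>UNIV. B j k * (\<Sum>m\<in>UNIV. DZ l m * C m j k)) =
      (\<Sum>j\<in>UNIV. \<Sum>m\<in>UNIV. \<Sum>k\<in>UNIV. DZ l m * (B j k * C m j k))"
      unfolding sum_distrib_left by (rule sum.cong[OF refl], subst sum.swap) (simp add: mult.left_commute)
    also have "\<dots> = (\<Sum>m\<in>UNIV. DZ l m * G m)"
      by (subst sum.swap) (simp add: G_def sum_distrib_left)
    finally show ?thesis .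
  qed
  have T5: "(\<Sum>j\<in>UNIV. \<Sum>k\<in>UNIV. B j k * (\<Sum>m\<in>UNIV. A l m * DDZ j k m)) =
      (\<Sum>m\<in>UNIV. A l m * (\<Sum>j\<in>UNIV. \<Sum>k\<in>UNIV. B j k * DDZ j k m))"
  proof -
    have "(\<Sum>j\<in>UNIV. \<Sum>k\<in>UNIV. B j k * (\<Sum>m\<in>UNIV. A l m * DDZ j k m)) =
      (\<Sum>j\<in>UNIV. \<Sum>m\<in>UNIV. \<Sum>k\<in>UNIV. A l m * (B j k * DDZ j k m))"
      unfolding sum_distrib_left by (rule sum.cong[OF refl], subst sum.swap) (simp add: mult.left_commute)
    also have "\<dots> = (\<Sum>m\<in>UNIV. A l m * (\<Sum>j\<in>UNIV. \<Sum>k\<in>UNIV. B j k * DDZ j k m))"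
      by (subst sum.swap) (simp add: sum_distrib_left)
    finally show ?thesis .
  qed
  have R: "(\<Sum>j\<in>UNIV. \<Sum>k\<in>UNIV. B j k * (dp k * A l j + dp j * A l k - dp l * A j k + 2 * p * C l j k))
      = (2 - real CARD('n)) * dp l + 2 * p * G l"
  proof -
    have a: "(\<Sum>j\<in>UNIV. \<Sum>k\<in>UNIV. B j k * (dp j * A l k)) = dp l"
    proof -
      have "(\<Sum>j\<in>UNIV. \<Sum>k\<in>UNIV. B j k * (dp j * A l k)) = (\<Sum>j\<in>UNIV. dp j * (\<Sum>k\<in>UNIV. A l k * B k j))"
        by (simp add: sum_distrib_left B mult_ac)
      then show ?thesis by (simp add: AB if_distrib[of "\<lambda>a. _ * a"] cong: if_cong)
    qed
    have b: "(\<Sum>j\<in>UNIV. \<Sum>k\<in>UNIV. B j k * (dp k * A l j)) = dp l"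
      by (subst a[symmetric], subst sum.swap) (simp add: B)
    have "(\<Sum>j\<in>UNIV. \<Sum>k\<in>UNIV. B j k * A j k) = real CARD('n)"
      using ginv_metric_contract[OF x] by (simp add: A_def B_def)
    then have c: "(\<Sum>j\<in>UNIV. \<Sum>k\<in>UNIV. B j k * (dp l * A j k)) = dp l * real CARD('n)"
      by (simp add: sum_distrib_left[symmetric] mult.left_commute[of _ "dp l"])
    have d: "(\<Sum>j\<in>UNIV. \<Sum>k\<in>UNIV. B j k * (2 * p * C l j k)) = 2 * p * G l"
      unfolding G_def by (simp add: sum_distrib_left mult_ac)
    have "(\<Sum>j\<in>UNIV. \<Sum>k\<in>UNIV. B j k * (dp k * A l j + dp j * A l k - dp l * A j k + 2 * p * C l j k)) =
       (\<Sum>j\<in>UNIV. \<Sum>k\<in>UNIV. B j k * (dp k * A l j)) + (\<Sum>j\<in>UNIV. \<Sum>k\<in>UNIV. B j k * (dp j * A l k))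
       - (\<Sum>j\<in>UNIV. \<Sum>k\<in>UNIV. B j k * (dp l * A j k)) + (\<Sum>j\<in>UNIV. \<Sum>k\<in>UNIV. B j k * (2 * p * C l j k))"
      by (simp only: distrib_left right_diff_distrib sum.distrib sum_subtractf)
    then show ?thesis unfolding a b c d by (simp add: algebra_simps)
  qed
  have "(\<Sum>m\<in>UNIV. Z m * DC m l j k) + (\<Sum>m\<in>UNIV. DZ k m * C l j m) + (\<Sum>m\<in>UNIV. DZ j m * C l m k)
      + (\<Sum>m\<in>UNIV. DZ l m * C m j k) + (\<Sum>m\<in>UNIV. A l m * DDZ j k m)
      = dp k * A l j + dp j * A l k - dp l * A j k + 2 * p * C l j k" for j k
    using lie_derivative_christoffel_lower[OF ckv x, of l j k]
    by (simp add: sum.distrib A_def Z_def DZ_def DDZ_def C_def DC_def dp_def p_def)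
  then have "(\<Sum>j\<in>UNIV. \<Sum>k\<in>UNIV. B j k * ((\<Sum>m\<in>UNIV. Z m * DC m l j k) + (\<Sum>m\<in>UNIV. DZ k m * C l j m)
      + (\<Sum>m\<in>UNIV. DZ j m * C l m k) + (\<Sum>m\<in>UNIV. DZ l m * C m j k) + (\<Sum>m\<in>UNIV. A l m * DDZ j k m)))
     = (2 - real CARD('n)) * dp l + 2 * p * G l"
    by (simp only: R)
  then have II: "T1 + T2 + T2 + (\<Sum>m\<in>UNIV. DZ l m * G m) + (\<Sum>m\<in>UNIV. A l m * (\<Sum>j\<in>UNIV. \<Sum>k\<in>UNIV. B j k * DDZ j k m))
     = (2 - real CARD('n)) * dp l + 2 * p * G l"
    by (simp only: distrib_left sum.distrib T3 T4 T5 T1_def[symmetric] T2_def[symmetric])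
  have "(\<Sum>m\<in>UNIV. Z m * (\<Sum>j\<in>UNIV. \<Sum>k\<in>UNIV. DB m j k * C l j k + B j k * DC m l j k))
      = T1 + T2 + T2 - 2 * p * G l"
  proof -
    have "(\<Sum>m\<in>UNIV. Z m * (\<Sum>j\<in>UNIV. \<Sum>k\<in>UNIV. DB m j k * C l j k + B j k * DC m l j k)) =
      (\<Sum>j\<in>UNIV. \<Sum>k\<in>UNIV. \<Sum>m\<in>UNIV. Z m * (DB m j k * C l j k + B j k * DC m l j k))"
      unfolding sum_distrib_left by (subst sum.swap) (intro sum.cong refl sum.swap)
    also have "\<dots> = (\<Sum>j\<in>UNIV. \<Sum>k\<in>UNIV. (\<Sum>m\<in>UNIV. Z m * DB m j k) * C l j k + B j k * (\<Sum>m\<in>UNIV. Z m * DC m l j k))"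
      by (simp add: sum.distrib sum_distrib_left sum_distrib_right algebra_simps)
    also have "\<dots> = (\<Sum>j\<in>UNIV. \<Sum>k\<in>UNIV. (\<Sum>a\<in>UNIV. B j a * DZ a k) * C l j k)
       + (\<Sum>j\<in>UNIV. \<Sum>k\<in>UNIV. (\<Sum>a\<in>UNIV. B k a * DZ a j) * C l j k) - 2 * p * G l + T1"
      unfolding raised T1_def G_def
      by (simp only: distrib_right left_diff_distrib sum.distrib sum_subtractf)
        (simp add: sum_distrib_left mult.assoc)
    also have "(\<Sum>j\<in>UNIV. \<Sum>k\<in>UNIV. (\<Sum>a\<in>UNIV. B k a * DZ a j) * C l j k) =
        (\<Sum>j\<in>UNIV. \<Sum>k\<in>UNIV. (\<Sum>a\<in>UNIV. B j a * DZ a k) * C l j k)"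
      by (subst sum.swap) (simp add: C)
    also have "(\<Sum>j\<in>UNIV. \<Sum>k\<in>UNIV. (\<Sum>a\<in>UNIV. B j a * DZ a k) * C l j k) = T2"
      unfolding T2_def sum_distrib_left sum_distrib_right
      by (rule sum.cong[OF refl], subst sum.swap) (simp add: mult.assoc)
    finally show ?thesis by simp
  qed
  with II have "(\<Sum>m\<in>UNIV. Z m * (\<Sum>j\<in>UNIV. \<Sum>k\<in>UNIV. DB m j k * C l j k + B j k * DC m l j k))
      + (\<Sum>m\<in>UNIV. DZ l m * G m) + (\<Sum>m\<in>UNIV. A l m * (\<Sum>j\<in>UNIV. \<Sum>k\<in>UNIV. B j k * DDZ j k m))
     = (2 - real CARD('n)) * dp l"
    by simp
  then show ?thesis
    by (simp only: pd_contracted_christoffel_lower[OF x] contracted_christoffel_lower_def A_def B_def Z_def DZ_def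
        DDZ_def C_def DC_def DB_def dp_def G_def)
qed

text \<open>
  All terms of the prolongation that are linear in \<open>p\<close> and involve derivatives of \<open>\<zeta>\<close> or of the contracted
  Christoffel symbols occur in the left-hand side; the right-hand side
  replaces them by the gradient of \<open>\<psi>\<close>. The identity is the previous one with its free index raised; the derivative of the metric appearing in
  \<open>\<gamma>\<^sub>l = g\<^sub>l\<^sub>i \<Gamma>\<^sup>i\<close> is eliminated by the conformal Killing equation.
\<close>

lemma lie_derivative_contracted_christoffel:
  assumes ckv: "conformal_killing U g \<zeta> \<psi>" and x: "x \<in> U"
  shows "(\<Sum>j\<in>UNIV. \<Sum>k\<in>UNIV. ginv g x j k * pd j (pd k (\<lambda>y. \<zeta> y $ i)) x)
       + (\<Sum>m\<in>UNIV. \<zeta> x $ m * pd m (contracted_christoffel g i) x)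
       - (\<Sum>m\<in>UNIV. contracted_christoffel g m x * pd m (\<lambda>y. \<zeta> y $ i) x)
       + 2 * \<psi> x * contracted_christoffel g i x
     = (2 - real CARD('n)) * (\<Sum>l\<in>UNIV. ginv g x i l * pd l \<psi> x)"
proof -
  define A where "A i j = g x $ i $ j" for i j
  define Z where "Z m = \<zeta> x $ m" for m
  define DZ where "DZ k m = pd k (\<lambda>y. \<zeta> y $ m) x" for k m
  define K where "K i = contracted_christoffel g i x" for i
  define DK where "DK m i = pd m (contracted_christoffel g i) x" for m i
  define DA where "DA k i j = pd k (\<lambda>y. g y $ i $ j) x" for k i j
  define W where "W i = (\<Sum>j\<in>UNIV. \<Sum>k\<in>UNIV. ginv g x j k * pd j (pd k (\<lambda>y. \<zeta> y $ i)) x)" for i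
  define p where "p = \<psi> x"
  have L: "(\<Sum>m\<in>UNIV. Z m * DA m l i) = 2 * p * A l i - (\<Sum>k\<in>UNIV. A k i * DZ l k) - (\<Sum>k\<in>UNIV. A l k * DZ i k)" for l i
  proof -
    have "lie_deriv_metric \<zeta> g l i x = 2 * \<psi> x * g x $ l $ i"
      using ckv x by (auto simp: conformal_killing_def)
    then show ?thesis
      by (simp add: lie_deriv_metric_def sum.distrib A_def Z_def DZ_def DA_def p_def)
  qed
  have dG: "pd m (contracted_christoffel_lower l) x = (\<Sum>i\<in>UNIV. A l i * DK m i + DA m l i * K i)" for m l
  proof -
    have "pd m (contracted_christoffel_lower l) x = pd m (\<lambda>y. \<Sum>i\<in>UNIV. g y $ l $ i * contracted_christoffel g i y) x"
      by (rule pd_cong[OF open_U x])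
        (auto simp: contracted_christoffel_lower_eq intro: smooth_on_differentiable[OF smooth_contracted_christoffel_lower x])
    then show ?thesis
      by (simp add: pd_sum[of _ U] pd_mult[of U] x open_U smooth_on_mult smooth_metric smooth_contracted_christoffel
          A_def DK_def DA_def K_def)
  qed
  have "(\<Sum>i\<in>UNIV. A l i * (W i + (\<Sum>m\<in>UNIV. Z m * DK m i) - (\<Sum>m\<in>UNIV. K m * DZ m i) + 2 * p * K i))
      = (2 - real CARD('n)) * pd l \<psi> x" for l
  proof -
    have s1: "(\<Sum>m\<in>UNIV. Z m * (\<Sum>i\<in>UNIV. A l i * DK m i + DA m l i * K i)) =
       (\<Sum>i\<in>UNIV. A l i * (\<Sum>m\<in>UNIV. Z m * DK m i)) + (\<Sum>i\<in>UNIV. (\<Sum>m\<in>UNIV. Z m * DA m l i) * K i)"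
    proof -
      have "(\<Sum>m\<in>UNIV. Z m * (\<Sum>i\<in>UNIV. A l i * DK m i + DA m l i * K i)) =
        (\<Sum>i\<in>UNIV. \<Sum>m\<in>UNIV. Z m * (A l i * DK m i + DA m l i * K i))"
        unfolding sum_distrib_left by (rule sum.swap)
      then show ?thesis by (simp add: sum.distrib sum_distrib_left sum_distrib_right algebra_simps)
    qed
    have s2: "(\<Sum>i\<in>UNIV. (\<Sum>k\<in>UNIV. A k i * DZ l k) * K i) = (\<Sum>m\<in>UNIV. DZ l m * (\<Sum>i\<in>UNIV. A m i * K i))"
      unfolding sum_distrib_left sum_distrib_right by (subst sum.swap) (simp add: mult_ac)
    have s3: "(\<Sum>i\<in>UNIV. (\<Sum>k\<in>UNIV. A l k * DZ i k) * K i) = (\<Sum>i\<in>UNIV. A l i * (\<Sum>m\<in>UNIV. K m * DZ m i))"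
      unfolding sum_distrib_left sum_distrib_right by (subst sum.swap) (simp add: mult_ac)
    have s4: "(\<Sum>i\<in>UNIV. (\<Sum>m\<in>UNIV. Z m * DA m l i) * K i) = (\<Sum>i\<in>UNIV. A l i * (2 * p * K i))
       - (\<Sum>m\<in>UNIV. DZ l m * (\<Sum>i\<in>UNIV. A m i * K i)) - (\<Sum>i\<in>UNIV. A l i * (\<Sum>m\<in>UNIV. K m * DZ m i))"
      unfolding L by (simp only: left_diff_distrib sum_subtractf s2 s3) (simp add: mult_ac)
    have "(\<Sum>m\<in>UNIV. Z m * (\<Sum>i\<in>UNIV. A l i * DK m i + DA m l i * K i))
       + (\<Sum>m\<in>UNIV. DZ l m * (\<Sum>i\<in>UNIV. A m i * K i)) + (\<Sum>m\<in>UNIV. A l m * W m) = (2 - real CARD('n)) * pd l \<psi> x"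
      using lie_derivative_contracted_christoffel_lower[OF ckv x, of l]
      by (simp only: dG contracted_christoffel_lower_eq[OF x] A_def Z_def DZ_def K_def W_def)
    then show ?thesis
      unfolding s1 s4 by (simp add: distrib_left right_diff_distrib sum.distrib sum_subtractf)
  qed
  note lowered = this
  have "W i + (\<Sum>m\<in>UNIV. Z m * DK m i) - (\<Sum>m\<in>UNIV. K m * DZ m i) + 2 * p * K i
      = (\<Sum>l\<in>UNIV. ginv g x i l * ((2 - real CARD('n)) * pd l \<psi> x))"
    using raise_index[OF x, of i "\<lambda>i. W i + (\<Sum>m\<in>UNIV. Z m * DK m i) - (\<Sum>m\<in>UNIV. K m * DZ m i) + 2 * p * K i"]
    by (simp only: lowered A_def[symmetric])
  then show ?thesis
    by (simp add: W_def Z_def DK_def K_def DZ_def p_def sum_distrib_left mult.left_commute)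
qed

end

section \<open>The second prolongation of a vector field\<close>

lemma frechet_derivative_eq_pdx_pdu:
  fixes F :: "'n::finite jet0 \<Rightarrow> real"
  assumes "F differentiable (at z)"
  shows "frechet_derivative F (at z) (v, s) = (\<Sum>k\<in>UNIV. v $ k * pdx k F z) + s * pdu F z"
proof -
  have l: "linear (frechet_derivative F (at z))"
    using assms has_derivative_linear frechet_derivative_works by blast
  have "(v, s) = (\<Sum>k\<in>UNIV. v $ k *\<^sub>R (axis k 1, 0)) + s *\<^sub>R (0, 1)"
    using basis_expansion[of v] by (simp add: prod_eq_iff fst_sum snd_sum scalar_mult_eq_scaleR)
  then have "frechet_derivative F (at z) (v, s) =
      frechet_derivative F (at z) ((\<Sum>k\<in>UNIV. v $ k *\<^sub>R (axis k 1, 0)) + s *\<^sub>R (0, 1))"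
    by (rule arg_cong)
  also have "\<dots> = (\<Sum>k\<in>UNIV. v $ k * pdx k F z) + s * pdu F z"
    by (simp only: linear_add[OF l] linear_sum[OF l] linear_scale[OF l] pdx_def pdu_def real_scaleR_def)
  finally show ?thesis .
qed

lemma total_deriv0_eq:
  fixes F :: "'n::finite jet0 \<Rightarrow> real"
  assumes "F differentiable (at (x, u))"
  shows "total_deriv0 i F (x, u, p) = pdx i F (x, u) + p $ i * pdu F (x, u)"
proof -
  have "(\<Sum>k\<in>UNIV. (axis i 1 :: real^'n) $ k * pdx k F (x, u)) = pdx i F (x, u)"
    by (simp add: axis_def if_distrib[of "\<lambda>a. a * _"] cong: if_cong)
  then show ?thesis using frechet_derivative_eq_pdx_pdu[OF assms, of "axis i 1" "p $ i"] by simp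
qed

lemma smooth_on_pdx: "smooth_on S F \<Longrightarrow> smooth_on S (pdx i F)"
  unfolding pdx_def by (rule smooth_on_frechet_derivative)

lemma smooth_on_pdu: "smooth_on S F \<Longrightarrow> smooth_on S (pdu F)"
  unfolding pdu_def by (rule smooth_on_frechet_derivative)

text \<open>
  The second total derivative of a function of \<open>(x, u)\<close> without its term in \<open>q\<close>.
\<close>

definition second_total :: "('n::finite jet0 \<Rightarrow> real) \<Rightarrow> 'n \<Rightarrow> 'n \<Rightarrow> 'n jet1 \<Rightarrow> real" where
  "second_total F i j w = total_deriv0 j (pdx i F) w + snd (snd w) $ i * total_deriv0 j (pdu F) w"

lemma has_derivative_pullback_jet0:
  assumes "smooth_on S F" "(x, u) \<in> S"
  shows "((\<lambda>w. F (fst w, fst (snd w))) has_derivative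
    (\<lambda>h. frechet_derivative F (at (x, u)) (fst h, fst (snd h)))) (at (x, u, r))"
proof (rule has_derivative_compose[where f = "\<lambda>w. (fst w, fst (snd w))" and g = F])
  show "(F has_derivative frechet_derivative F (at (x, u))) (at (fst (x, u, r), fst (snd (x, u, r))))"
    using smooth_on_has_derivative[OF assms] by simp
qed (auto intro!: derivative_eq_intros)

lemma has_derivative_total_deriv0:
  fixes F :: "'n::finite jet0 \<Rightarrow> real"
  assumes S: "open S" "smooth_on S F" "(x, u) \<in> S"
  shows "(total_deriv0 i F has_derivative
    (\<lambda>h. frechet_derivative (pdx i F) (at (x, u)) (fst h, fst (snd h))
       + (p $ i * frechet_derivative (pdu F) (at (x, u)) (fst h, fst (snd h))
       + snd (snd h) $ i * pdu F (x, u)))) (at (x, u, p))"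
proof -
  let ?D = "\<lambda>w. pdx i F (fst w, fst (snd w)) + snd (snd w) $ i * pdu F (fst w, fst (snd w))"
  let ?V = "(\<lambda>w :: 'n jet1. (fst w, fst (snd w))) -` S"
  have "((\<lambda>w. snd (snd w) $ i) has_derivative (\<lambda>h. snd (snd h) $ i)) (at (x, u, p))"
    by (rule bounded_linear_imp_has_derivative)
      (intro bounded_linear_compose[OF bounded_linear_vec_nth] bounded_linear_compose[OF bounded_linear_snd] bounded_linear_snd)
  from has_derivative_add[OF has_derivative_pullback_jet0[OF smooth_on_pdx[OF S(2)] S(3)]
      has_derivative_mult[OF this has_derivative_pullback_jet0[OF smooth_on_pdu[OF S(2)] S(3)]]]
  have "(?D has_derivative (\<lambda>h. frechet_derivative (pdx i F) (at (x, u)) (fst h, fst (snd h))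
       + (p $ i * frechet_derivative (pdu F) (at (x, u)) (fst h, fst (snd h))
       + snd (snd h) $ i * pdu F (x, u)))) (at (x, u, p))"
    by simp
  moreover have "open ?V"
    by (intro open_vimage S(1) continuous_intros)
  moreover have "(x, u, p) \<in> ?V" using S(3) by simp
  moreover have "?D w = total_deriv0 i F w" if "w \<in> ?V" for w
    using that smooth_on_differentiable[OF S(2)]
    by (cases w) (simp add: total_deriv0_eq del: total_deriv0.simps)
  ultimately show ?thesis
    by (rule has_derivative_transform_within_open) auto
qed

text \<open>
  The product rule for total derivatives, with the dependence on \<open>q\<close> separated: it enters only through
  \<open>\<partial>\<^sub>u\<close> of the components and through differentiating the explicit factors \<open>p\<^sub>k\<close>.
\<close>

lemma total_deriv1_prolong1:
  fixes \<eta> :: "'n::finite jet0 \<Rightarrow> real"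
  assumes S: "open S" "smooth_on S \<xi>" "smooth_on S \<eta>" "(x, u) \<in> S"
  shows "total_deriv1 j (prolong1 \<xi> \<eta> i) (x, u, p, q) =
     second_total \<eta> i j (x, u, p) + q $ j $ i * pdu \<eta> (x, u)
     - (\<Sum>k\<in>UNIV. p $ k * (second_total (\<lambda>z. \<xi> z $ k) i j (x, u, p) + q $ j $ i * pdu (\<lambda>z. \<xi> z $ k) (x, u))
         + q $ j $ k * total_deriv0 i (\<lambda>z. \<xi> z $ k) (x, u, p))"
proof -
  have sk: "smooth_on S (\<lambda>z. \<xi> z $ k)" for k by (intro smooth_on_nth S)
  have D: "second_total F i j (x, u, p) + q $ j $ i * pdu F (x, u) =
     frechet_derivative (pdx i F) (at (x, u)) (axis j 1, p $ j)
       + (p $ i * frechet_derivative (pdu F) (at (x, u)) (axis j 1, p $ j) + q $ j $ i * pdu F (x, u))" for F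
    by (simp add: second_total_def)
  have eq: "prolong1 \<xi> \<eta> i = (\<lambda>w. total_deriv0 i \<eta> w
      - (\<Sum>k\<in>UNIV. snd (snd w) $ k * total_deriv0 i (\<lambda>z. \<xi> z $ k) w))"
    by (rule ext) (auto simp del: total_deriv0.simps)
  have p: "((\<lambda>w. snd (snd w) $ k) has_derivative (\<lambda>h. snd (snd h) $ k)) (at (x, u, p))" for k
    by (rule bounded_linear_imp_has_derivative)
      (intro bounded_linear_compose[OF bounded_linear_vec_nth] bounded_linear_compose[OF bounded_linear_snd] bounded_linear_snd)
  note d = has_derivative_diff[OF has_derivative_total_deriv0[OF S(1,3,4), where i = i and p = p]
      has_derivative_sum[of UNIV, OF has_derivative_mult[OF p has_derivative_total_deriv0[OF S(1) sk S(4), where i = i and p = p]]]]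
  show ?thesis
    unfolding total_deriv1.simps eq frechet_derivative_eqI[OF d] D by (simp del: total_deriv0.simps)
qed

context coordinate_metric
begin

lemma second_prolongation_poisson:
  assumes J: "open J" and f: "smooth_on (U \<times> J) f" and x: "x \<in> U" and u: "u \<in> J"
  shows "second_prolongation \<xi> \<eta> (poisson_eq g f) (x, u, p, q) =
     (\<Sum>i\<in>UNIV. \<Sum>j\<in>UNIV. ginv g x i j * prolong2 \<xi> \<eta> i j (x, u, p, q)
        + (\<Sum>k\<in>UNIV. \<xi> (x, u) $ k * pd k (\<lambda>y. ginv g y i j) x) * q $ i $ j)
     - (\<Sum>i\<in>UNIV. contracted_christoffel g i x * prolong1 \<xi> \<eta> i (x, u, p)
        + (\<Sum>k\<in>UNIV. \<xi> (x, u) $ k * pd k (contracted_christoffel g i) x) * p $ i)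
     - ((\<Sum>k\<in>UNIV. \<xi> (x, u) $ k * pdx k f (x, u)) + \<eta> (x, u) * pdu f (x, u))"
proof -
  have z: "(x, u) \<in> U \<times> J" using x u by simp
  have eq: "poisson_eq g f = (\<lambda>w. (\<Sum>i\<in>UNIV. \<Sum>j\<in>UNIV. ginv g (fst w) i j * snd (snd (snd w)) $ i $ j)
     - (\<Sum>i\<in>UNIV. contracted_christoffel g i (fst w) * fst (snd (snd w)) $ i) - f (fst w, fst (snd w)))"
    by (rule ext) auto
  have X: "((\<lambda>w. F (fst w)) has_derivative (\<lambda>h. frechet_derivative F (at x) (fst h))) (at (x, u, p, q))"
    if "smooth_on U F" for F :: "real^'n \<Rightarrow> real"
  proof (rule has_derivative_compose[where f = fst and g = F])
    show "(F has_derivative frechet_derivative F (at x)) (at (fst (x, u, p, q)))"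
      using smooth_on_has_derivative[OF that x] by simp
  qed (auto intro!: derivative_eq_intros)
  have P: "((\<lambda>w. fst (snd (snd w)) $ i) has_derivative (\<lambda>h. fst (snd (snd h)) $ i)) (at (x, u, p, q))" for i
    by (rule bounded_linear_imp_has_derivative)
      (intro bounded_linear_compose[OF bounded_linear_vec_nth] bounded_linear_compose[OF bounded_linear_fst]
        bounded_linear_compose[OF bounded_linear_snd] bounded_linear_snd)
  have Q: "((\<lambda>w. snd (snd (snd w)) $ i $ j) has_derivative (\<lambda>h. snd (snd (snd h)) $ i $ j)) (at (x, u, p, q))" for i j
    by (rule bounded_linear_imp_has_derivative)
      (intro bounded_linear_compose[OF bounded_linear_vec_nth] bounded_linear_compose[OF bounded_linear_snd] bounded_linear_snd)
  note d = has_derivative_diff[OF has_derivative_diff[OF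
      has_derivative_sum[of UNIV, OF has_derivative_sum[of UNIV, OF has_derivative_mult[OF X[OF smooth_ginv] Q]]]
      has_derivative_sum[of UNIV, OF has_derivative_mult[OF X[OF smooth_contracted_christoffel] P]]]
      has_derivative_pullback_jet0[OF f z]]
  show ?thesis
    unfolding second_prolongation.simps eq frechet_derivative_eqI[OF d]
    by (simp add: frechet_derivative_eq_pdx_pdu[OF smooth_on_differentiable[OF f z]]
        frechet_derivative_eq_sum_pd[OF smooth_on_differentiable[OF smooth_ginv x]]
        frechet_derivative_eq_sum_pd[OF smooth_on_differentiable[OF smooth_contracted_christoffel x]]
        del: prolong1.simps prolong2.simps)
qed

text \<open>
  The coefficient of \<open>q\<^sub>i\<^sub>j\<close> in the prolonged field applied to the equation, symmetrised in \<open>i\<close> and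
  \<open>j\<close>; only the symmetric part is determined, because \<open>q\<close> ranges over symmetric matrices.
\<close>

definition symbol_coeff where
  "symbol_coeff \<xi> \<eta> x u p i j = (\<Sum>k\<in>UNIV. \<xi> (x, u) $ k * pd k (\<lambda>y. ginv g y i j) x)
     + ginv g x i j * (pdu \<eta> (x, u) - (\<Sum>k\<in>UNIV. p $ k * pdu (\<lambda>z. \<xi> z $ k) (x, u)))
     - (\<Sum>k\<in>UNIV. ginv g x i k * total_deriv0 k (\<lambda>z. \<xi> z $ j) (x, u, p))
     - (\<Sum>k\<in>UNIV. ginv g x j k * total_deriv0 k (\<lambda>z. \<xi> z $ i) (x, u, p))"

definition lower_order_part where
  "lower_order_part f \<xi> \<eta> x u p =
     (\<Sum>i\<in>UNIV. \<Sum>j\<in>UNIV. ginv g x i j * (second_total \<eta> i j (x, u, p)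
         - (\<Sum>k\<in>UNIV. p $ k * second_total (\<lambda>z. \<xi> z $ k) i j (x, u, p))))
     - (\<Sum>i\<in>UNIV. contracted_christoffel g i x * prolong1 \<xi> \<eta> i (x, u, p)
        + (\<Sum>k\<in>UNIV. \<xi> (x, u) $ k * pd k (contracted_christoffel g i) x) * p $ i)
     - ((\<Sum>k\<in>UNIV. \<xi> (x, u) $ k * pdx k f (x, u)) + \<eta> (x, u) * pdu f (x, u))"

lemma symbol_coeff_commute: "x \<in> U \<Longrightarrow> symbol_coeff \<xi> \<eta> x u p i j = symbol_coeff \<xi> \<eta> x u p j i"
proof -
  assume x: "x \<in> U"
  have "pd k (\<lambda>y. ginv g y i j) x = pd k (\<lambda>y. ginv g y j i) x" for k
    by (rule pd_cong[OF open_U x]) (auto simp: ginv_commute intro: smooth_on_differentiable[OF smooth_ginv x])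
  then show ?thesis by (simp add: symbol_coeff_def ginv_commute[OF x, of i j])
qed

lemma second_prolongation_poisson_split:
  assumes J: "open J" and sm: "smooth_on (U \<times> J) f" "smooth_on (U \<times> J) \<xi>" "smooth_on (U \<times> J) \<eta>"
    and x: "x \<in> U" and u: "u \<in> J" and q: "transpose q = q"
  shows "second_prolongation \<xi> \<eta> (poisson_eq g f) (x, u, p, q) =
     (\<Sum>i\<in>UNIV. \<Sum>j\<in>UNIV. symbol_coeff \<xi> \<eta> x u p i j * q $ i $ j) + lower_order_part f \<xi> \<eta> x u p"
proof -
  have z: "(x, u) \<in> U \<times> J" and S: "open (U \<times> J)" using x u open_U J by (auto intro: open_Times)
  define B where "B i j = ginv g x i j" for i j
  define T where "T k i = total_deriv0 i (\<lambda>z. \<xi> z $ k) (x, u, p)" for k i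
  define s where "s i j = second_total \<eta> i j (x, u, p) - (\<Sum>k\<in>UNIV. p $ k * second_total (\<lambda>z. \<xi> z $ k) i j (x, u, p))" for i j
  define a where "a = pdu \<eta> (x, u) - (\<Sum>k\<in>UNIV. p $ k * pdu (\<lambda>z. \<xi> z $ k) (x, u))"
  have B: "B i j = B j i" for i j unfolding B_def by (rule ginv_commute[OF x])
  have q': "q $ i $ j = q $ j $ i" for i j using q unfolding transpose_def vec_eq_iff by auto
  have pr: "prolong2 \<xi> \<eta> i j (x, u, p, q) = s i j + a * q $ i $ j - (\<Sum>k\<in>UNIV. q $ j $ k * T k i) - (\<Sum>k\<in>UNIV. q $ i $ k * T k j)" for i j
  proof -
    have "prolong2 \<xi> \<eta> i j (x, u, p, q) = total_deriv1 j (prolong1 \<xi> \<eta> i) (x, u, p, q) - (\<Sum>k\<in>UNIV. q $ i $ k * T k j)"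
      by (simp add: T_def del: total_deriv0.simps total_deriv1.simps)
    then show ?thesis
      unfolding total_deriv1_prolong1[OF S sm(2,3) z] s_def a_def T_def
      by (simp add: q'[of j i] sum.distrib distrib_left distrib_right left_diff_distrib right_diff_distrib sum_distrib_left sum_distrib_right mult_ac
          del: total_deriv0.simps)
  qed
  have e1: "(\<Sum>i\<in>UNIV. \<Sum>j\<in>UNIV. B i j * (\<Sum>k\<in>UNIV. q $ i $ k * T k j)) =
      (\<Sum>i\<in>UNIV. \<Sum>j\<in>UNIV. (\<Sum>k\<in>UNIV. B i k * T j k) * q $ i $ j)"
    unfolding sum_distrib_left sum_distrib_right
    by (rule sum.cong[OF refl], subst sum.swap) (simp add: mult_ac)
  have e2: "(\<Sum>i\<in>UNIV. \<Sum>j\<in>UNIV. B i j * (\<Sum>k\<in>UNIV. q $ j $ k * T k i)) =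
      (\<Sum>i\<in>UNIV. \<Sum>j\<in>UNIV. (\<Sum>k\<in>UNIV. B i k * T j k) * q $ i $ j)"
    unfolding e1[symmetric] by (subst sum.swap) (simp add: B)
  have e3: "(\<Sum>i\<in>UNIV. \<Sum>j\<in>UNIV. (\<Sum>k\<in>UNIV. B j k * T i k) * q $ i $ j) =
      (\<Sum>i\<in>UNIV. \<Sum>j\<in>UNIV. (\<Sum>k\<in>UNIV. B i k * T j k) * q $ i $ j)"
    by (subst sum.swap) (simp add: q')
  have "(\<Sum>i\<in>UNIV. \<Sum>j\<in>UNIV. B i j * (s i j + a * q $ i $ j - (\<Sum>k\<in>UNIV. q $ j $ k * T k i) - (\<Sum>k\<in>UNIV. q $ i $ k * T k j))
        + (\<Sum>k\<in>UNIV. \<xi> (x, u) $ k * pd k (\<lambda>y. ginv g y i j) x) * q $ i $ j) =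
     (\<Sum>i\<in>UNIV. \<Sum>j\<in>UNIV. symbol_coeff \<xi> \<eta> x u p i j * q $ i $ j) + (\<Sum>i\<in>UNIV. \<Sum>j\<in>UNIV. B i j * s i j)"
    unfolding symbol_coeff_def a_def[symmetric] T_def[symmetric] B_def[symmetric]
    by (simp only: distrib_left distrib_right left_diff_distrib right_diff_distrib sum.distrib sum_subtractf e1 e2 e3)
      (simp add: mult_ac)
  then show ?thesis
    unfolding second_prolongation_poisson[OF J sm(1) x u] pr lower_order_part_def s_def[symmetric] B_def[symmetric] by simp
qed

end

section \<open>Fields that are affine in the dependent variable\<close>

lemma frechet_derivative_affine:
  fixes c b :: "real^'n::finite \<Rightarrow> real"
  assumes "open U" "open J" and x: "x \<in> U" and u: "u \<in> J"
    and c: "smooth_on U c" and b: "smooth_on U b"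
    and F: "\<And>x u. x \<in> U \<Longrightarrow> u \<in> J \<Longrightarrow> F (x, u) = c x * u + b x"
  shows "frechet_derivative F (at (x, u)) (v, s) =
    frechet_derivative c (at x) v * u + c x * s + frechet_derivative b (at x) v"
proof -
  have X: "((\<lambda>z. G (fst z)) has_derivative (\<lambda>h. frechet_derivative G (at x) (fst h))) (at (x, u))"
    if "smooth_on U G" for G :: "real^'n \<Rightarrow> real"
  proof (rule has_derivative_compose[where f = fst and g = G])
    show "(G has_derivative frechet_derivative G (at x)) (at (fst (x, u)))"
      using smooth_on_has_derivative[OF that x] by simp
  qed (auto intro!: derivative_eq_intros)
  have "((\<lambda>z. c (fst z) * snd z + b (fst z)) has_derivative
      (\<lambda>h. c (fst (x, u)) * snd h + frechet_derivative c (at x) (fst h) * snd (x, u)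
        + frechet_derivative b (at x) (fst h))) (at (x, u))"
    by (intro has_derivative_add has_derivative_mult X c b has_derivative_snd has_derivative_ident)
  then have "(F has_derivative
      (\<lambda>h. c (fst (x, u)) * snd h + frechet_derivative c (at x) (fst h) * snd (x, u)
        + frechet_derivative b (at x) (fst h))) (at (x, u))"
    by (rule has_derivative_transform_within_open[of _ _ _ _ "U \<times> J"]) (use assms in \<open>auto intro: open_Times\<close>)
  from frechet_derivative_eqI[OF this] show ?thesis by simp
qed

context
  fixes U :: "(real^'n::finite) set" and J :: "real set" and F :: "'n jet0 \<Rightarrow> real"
    and c b :: "real^'n \<Rightarrow> real"
  assumes U: "open U" and J: "open J" and c: "smooth_on U c" and b: "smooth_on U b"
    and F: "\<And>x u. x \<in> U \<Longrightarrow> u \<in> J \<Longrightarrow> F (x, u) = c x * u + b x"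
begin

lemma pdx_affine: "x \<in> U \<Longrightarrow> u \<in> J \<Longrightarrow> pdx i F (x, u) = pd i c x * u + pd i b x"
  by (simp add: pdx_def pd_def frechet_derivative_affine[OF U J _ _ c b F])

lemma pdu_affine: "x \<in> U \<Longrightarrow> u \<in> J \<Longrightarrow> pdu F (x, u) = c x"
  using linear_0[OF has_derivative_linear[OF smooth_on_has_derivative[OF c]]]
    linear_0[OF has_derivative_linear[OF smooth_on_has_derivative[OF b]]]
  by (simp add: pdu_def frechet_derivative_affine[OF U J _ _ c b F])

lemma total_deriv0_affine:
  "x \<in> U \<Longrightarrow> u \<in> J \<Longrightarrow> total_deriv0 i F (x, u, p) = pd i c x * u + c x * p $ i + pd i b x"
  by (simp add: pd_def frechet_derivative_affine[OF U J _ _ c b F])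

end

lemma second_total_affine:
  assumes "open U" "open J" and c: "smooth_on U c" and b: "smooth_on U b"
    and F: "\<And>x u. x \<in> U \<Longrightarrow> u \<in> J \<Longrightarrow> F (x, u) = c x * u + b x"
    and x: "x \<in> U" and u: "u \<in> J"
  shows "second_total F i j (x, u, p) =
     pd j (pd i c) x * u + pd j (pd i b) x + p $ j * pd i c x + p $ i * pd j c x"
proof -
  have "total_deriv0 j (pdx i F) (x, u, p) = pd j (pd i c) x * u + pd i c x * p $ j + pd j (pd i b) x"
    by (rule total_deriv0_affine[OF assms(1,2) smooth_on_pd[OF c] smooth_on_pd[OF b] _ x u])
      (rule pdx_affine[OF assms(1-5)])
  moreover have "total_deriv0 j (pdu F) (x, u, p) = pd j (\<lambda>x. 0) x * u + 0 * p $ j + pd j c x"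
    by (rule total_deriv0_affine[OF assms(1,2) smooth_on_const c _ x u])
      (simp add: pdu_affine[OF assms(1-5)])
  ultimately show ?thesis
    by (simp add: second_total_def algebra_simps del: total_deriv0.simps)
qed

text \<open>
  The only place where the connectedness of \<open>J\<close> enters: it is used with \<open>c = 0\<close> to make \<open>\<xi>\<close> and
  \<open>\<partial>\<^sub>u \<eta>\<close> independent of \<open>u\<close>, and then with \<open>c = \<partial>\<^sub>u \<eta>\<close> to make \<open>\<eta>\<close> affine.
\<close>

lemma affine_of_constant_pdu:
  fixes F :: "'n::finite jet0 \<Rightarrow> real"
  assumes F: "smooth_on (U \<times> J) F" and J: "open J" "connected J" and x: "x \<in> U"
    and c: "\<And>u. u \<in> J \<Longrightarrow> pdu F (x, u) = c" and u: "u \<in> J" "u\<^sub>0 \<in> J"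
  shows "F (x, u) = F (x, u\<^sub>0) + c * (u - u\<^sub>0)"
proof -
  have D: "((\<lambda>u. F (x, u) - c * u) has_real_derivative 0) (at u)" if "u \<in> J" for u
  proof -
    have z: "(x, u) \<in> U \<times> J" using x that by simp
    note d = smooth_on_has_derivative[OF F z]
    have "((\<lambda>u. F (x, u)) has_derivative (\<lambda>h. frechet_derivative F (at (x, u)) (0, h))) (at u)"
      by (rule has_derivative_compose[where f = "\<lambda>u. (x, u)" and g = F, OF _ d]) (auto intro!: derivative_eq_intros)
    moreover have "frechet_derivative F (at (x, u)) (0, h) = c * h" for h
      using frechet_derivative_eq_pdx_pdu[OF smooth_on_differentiable[OF F z], of 0 h] c[OF that] by simp
    ultimately have "((\<lambda>u. F (x, u)) has_real_derivative c) (at u)"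
      by (simp add: has_field_derivative_def)
    then show ?thesis
      using DERIV_diff[OF _ DERIV_cmult[OF DERIV_ident, of c]] by fastforce
  qed
  have "(\<lambda>u. F (x, u) - c * u) constant_on J"
    using D J(2,1) by (rule has_field_derivative_0_imp_constant_on)
  then obtain k where "\<And>u. u \<in> J \<Longrightarrow> F (x, u) - c * u = k"
    unfolding constant_on_def by auto
  from this[OF u(1)] this[OF u(2)] show ?thesis by (simp add: algebra_simps)
qed

context coordinate_metric
begin

lemma contract_cov_hessian:
  "(\<Sum>i\<in>UNIV. \<Sum>j\<in>UNIV. ginv g x i j * cov_hessian g w i j x) = laplacian g w x"
proof -
  have "(\<Sum>i\<in>UNIV. \<Sum>j\<in>UNIV. ginv g x i j * (\<Sum>k\<in>UNIV. christoffel g k i j x * pd k w x)) =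
    (\<Sum>i\<in>UNIV. \<Sum>k\<in>UNIV. \<Sum>j\<in>UNIV. ginv g x i j * christoffel g k i j x * pd k w x)"
    unfolding sum_distrib_left by (rule sum.cong[OF refl], subst sum.swap) (simp add: mult.assoc)
  also have "\<dots> = (\<Sum>k\<in>UNIV. contracted_christoffel g k x * pd k w x)"
    by (subst sum.swap) (simp add: contracted_christoffel_def sum_distrib_right)
  finally show ?thesis
    by (simp add: cov_hessian_def laplacian_def right_diff_distrib sum_subtractf)
qed

lemma laplacian_affine:
  assumes "smooth_on U w" "x \<in> U" and v: "\<And>y. y \<in> U \<Longrightarrow> v y = a * w y + k"
  shows "laplacian g v x = a * laplacian g w x"
proof -
  have 1: "pd i v y = a * pd i w y" if "y \<in> U" for i y
  proof -
    have "smooth_on U (\<lambda>y. a * w y + k)"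
      by (intro smooth_intros assms open_U)
    then have "smooth_on U v" using smooth_on_cong[OF open_U, of v "\<lambda>y. a * w y + k"] v by blast
    then have "pd i v y = pd i (\<lambda>y. a * w y + k) y"
      by (intro pd_cong[OF open_U that] smooth_on_differentiable[OF _ that]) (auto simp: v)
    then show ?thesis
      using assms(1) that by (simp add: pd_add[of U] pd_cmult[of U] smooth_on_const smooth_on_mult open_U)
  qed
  have 2: "pd j (pd i v) x = a * pd j (pd i w) x" for i j
  proof -
    have "pd j (pd i v) x = pd j (\<lambda>y. a * pd i w y) x"
    proof (rule pd_cong[OF open_U assms(2), symmetric])
      show "(\<lambda>y. a * pd i w y) differentiable at x"
        by (intro smooth_on_differentiable[OF _ assms(2)] smooth_intros assms open_U)
    qed (simp add: 1)
    then show ?thesis using assms by (simp add: pd_cmult[of U] smooth_on_pd)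
  qed
  show ?thesis
    using assms(2) by (simp add: laplacian_def 1 2 sum_distrib_left right_diff_distrib mult.left_commute)
qed

end

text \<open>
  The shape that every symmetry turns out to have. Both directions of the theorem evaluate the
  prolongation here: one after establishing this shape, the other for a given field.
\<close>

locale affine_field = coordinate_metric U g for U :: "(real^'n::finite) set" and g +
  fixes J :: "real set" and \<xi> :: "'n jet0 \<Rightarrow> real^'n" and \<eta> f :: "'n jet0 \<Rightarrow> real"
    and \<zeta> :: "real^'n \<Rightarrow> real^'n" and c b :: "real^'n \<Rightarrow> real"
  assumes open_J: "open J"
    and smooth_f: "smooth_on (U \<times> J) f" and smooth_\<xi>: "smooth_on (U \<times> J) \<xi>" and smooth_\<eta>: "smooth_on (U \<times> J) \<eta>"
    and smooth_\<zeta>: "smooth_on U \<zeta>" and smooth_c: "smooth_on U c" and smooth_b: "smooth_on U b"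
    and \<xi>_eq: "\<And>x u. x \<in> U \<Longrightarrow> u \<in> J \<Longrightarrow> \<xi> (x, u) = \<zeta> x"
    and \<eta>_eq: "\<And>x u. x \<in> U \<Longrightarrow> u \<in> J \<Longrightarrow> \<eta> (x, u) = c x * u + b x"
begin

lemma \<xi>_nth_eq: "x \<in> U \<Longrightarrow> u \<in> J \<Longrightarrow> \<xi> (x, u) $ k = 0 * u + \<zeta> x $ k"
  by (simp add: \<xi>_eq)

lemmas \<xi>_affine = open_U open_J smooth_on_const[of U 0] smooth_on_nth[OF open_U smooth_\<zeta>] \<xi>_nth_eq
lemmas \<eta>_affine = open_U open_J smooth_c smooth_b \<eta>_eq

lemma pdu_\<xi>: "x \<in> U \<Longrightarrow> u \<in> J \<Longrightarrow> pdu (\<lambda>z. \<xi> z $ k) (x, u) = 0"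
  by (rule pdu_affine[OF \<xi>_affine])

lemma total_deriv0_\<xi>: "x \<in> U \<Longrightarrow> u \<in> J \<Longrightarrow> total_deriv0 i (\<lambda>z. \<xi> z $ k) (x, u, p) = pd i (\<lambda>y. \<zeta> y $ k) x"
proof -
  assume a: "x \<in> U" "u \<in> J"
  have "total_deriv0 i (\<lambda>z. \<xi> z $ k) (x, u, p) = pd i (\<lambda>y. 0) x * u + 0 * p $ i + pd i (\<lambda>y. \<zeta> y $ k) x"
    by (rule total_deriv0_affine[OF \<xi>_affine]) (use a in simp_all)
  then show ?thesis by simp
qed

lemma second_total_\<xi>: "x \<in> U \<Longrightarrow> u \<in> J \<Longrightarrow>
    second_total (\<lambda>z. \<xi> z $ k) i j (x, u, p) = pd j (pd i (\<lambda>y. \<zeta> y $ k)) x"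
proof -
  assume a: "x \<in> U" "u \<in> J"
  have "pd i (\<lambda>y. 0) = (\<lambda>y::real^'n. 0)" by (rule ext) simp
  moreover have "second_total (\<lambda>z. \<xi> z $ k) i j (x, u, p) = pd j (pd i (\<lambda>y. 0)) x * u
      + pd j (pd i (\<lambda>y. \<zeta> y $ k)) x + p $ j * pd i (\<lambda>y. 0) x + p $ i * pd j (\<lambda>y. 0) x"
    by (rule second_total_affine[OF \<xi>_affine]) (use a in simp_all)
  ultimately show ?thesis by simp
qed

lemma symbol_coeff_affine:
  assumes "x \<in> U" "u \<in> J"
  shows "symbol_coeff \<xi> \<eta> x u p i j = (\<Sum>k\<in>UNIV. \<zeta> x $ k * pd k (\<lambda>y. ginv g y i j) x)
        - (\<Sum>k\<in>UNIV. ginv g x i k * pd k (\<lambda>y. \<zeta> y $ j) x)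
        - (\<Sum>k\<in>UNIV. ginv g x j k * pd k (\<lambda>y. \<zeta> y $ i) x) + c x * ginv g x i j"
  using assms by (simp add: symbol_coeff_def pdu_\<xi> total_deriv0_\<xi> \<xi>_eq pdu_affine[OF \<eta>_affine] del: total_deriv0.simps)

lemma lower_order_part_affine:
  assumes x: "x \<in> U" and u: "u \<in> J"
  shows "lower_order_part f \<xi> \<eta> x u p =
     u * laplacian g c x + laplacian g b x - (\<Sum>k\<in>UNIV. \<zeta> x $ k * pdx k f (x, u)) - (c x * u + b x) * pdu f (x, u)
     + (\<Sum>i\<in>UNIV. p $ i * (2 * (\<Sum>j\<in>UNIV. ginv g x i j * pd j c x)
          - (\<Sum>j\<in>UNIV. \<Sum>k\<in>UNIV. ginv g x j k * pd j (pd k (\<lambda>y. \<zeta> y $ i)) x)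
          - c x * contracted_christoffel g i x
          + (\<Sum>j\<in>UNIV. contracted_christoffel g j x * pd j (\<lambda>y. \<zeta> y $ i) x)
          - (\<Sum>k\<in>UNIV. \<zeta> x $ k * pd k (contracted_christoffel g i) x)))"
proof -
  define B where "B i j = ginv g x i j" for i j
  define K where "K i = contracted_christoffel g i x" for i
  define DZ where "DZ k m = pd k (\<lambda>y. \<zeta> y $ m) x" for k m
  define DDZ where "DDZ j k m = pd j (pd k (\<lambda>y. \<zeta> y $ m)) x" for j k m
  define dc where "dc k = pd k c x" for k
  define \<tau> where "\<tau> i = (\<Sum>k\<in>UNIV. \<zeta> x $ k * pd k (contracted_christoffel g i) x)" for i
  have B: "B i j = B j i" for i j unfolding B_def by (rule ginv_commute[OF x])
  have st: "second_total \<eta> i j (x, u, p) = pd j (pd i c) x * u + pd j (pd i b) x + p $ j * dc i + p $ i * dc j" for i j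
    unfolding dc_def by (rule second_total_affine[OF \<eta>_affine x u])
  have p1: "prolong1 \<xi> \<eta> i (x, u, p) = dc i * u + c x * p $ i + pd i b x - (\<Sum>j\<in>UNIV. p $ j * DZ i j)" for i
    by (simp add: total_deriv0_\<xi>[OF x u] total_deriv0_affine[OF \<eta>_affine x u] DZ_def dc_def del: total_deriv0.simps)
  have e1: "(\<Sum>i\<in>UNIV. \<Sum>j\<in>UNIV. B i j * (p $ j * dc i)) = (\<Sum>i\<in>UNIV. p $ i * (\<Sum>j\<in>UNIV. B i j * dc j))"
    by (subst sum.swap) (simp add: B sum_distrib_left mult_ac)
  have e2: "(\<Sum>i\<in>UNIV. \<Sum>j\<in>UNIV. B i j * (p $ i * dc j)) = (\<Sum>i\<in>UNIV. p $ i * (\<Sum>j\<in>UNIV. B i j * dc j))"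
    by (simp add: sum_distrib_left mult_ac)
  have e3: "(\<Sum>i\<in>UNIV. \<Sum>j\<in>UNIV. B i j * (\<Sum>k\<in>UNIV. p $ k * DDZ j i k)) =
      (\<Sum>i\<in>UNIV. p $ i * (\<Sum>j\<in>UNIV. \<Sum>k\<in>UNIV. B j k * DDZ j k i))"
  proof -
    have "(\<Sum>i\<in>UNIV. \<Sum>j\<in>UNIV. B i j * (\<Sum>k\<in>UNIV. p $ k * DDZ j i k)) =
      (\<Sum>j\<in>UNIV. \<Sum>i\<in>UNIV. \<Sum>k\<in>UNIV. p $ k * (B j i * DDZ j i k))"
      by (subst sum.swap) (simp add: B sum_distrib_left mult_ac)
    also have "\<dots> = (\<Sum>j\<in>UNIV. \<Sum>k\<in>UNIV. \<Sum>i\<in>UNIV. p $ k * (B j i * DDZ j i k))"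
      by (rule sum.cong[OF refl], rule sum.swap)
    also have "\<dots> = (\<Sum>k\<in>UNIV. p $ k * (\<Sum>j\<in>UNIV. \<Sum>i\<in>UNIV. B j i * DDZ j i k))"
      by (subst sum.swap) (simp add: sum_distrib_left)
    finally show ?thesis .
  qed
  have e4: "(\<Sum>i\<in>UNIV. K i * (\<Sum>j\<in>UNIV. p $ j * DZ i j)) = (\<Sum>i\<in>UNIV. p $ i * (\<Sum>j\<in>UNIV. K j * DZ j i))"
    unfolding sum_distrib_left by (subst sum.swap) (simp add: mult_ac)
  have L: "laplacian g w x = (\<Sum>i\<in>UNIV. \<Sum>j\<in>UNIV. B i j * pd j (pd i w) x) - (\<Sum>i\<in>UNIV. K i * pd i w x)" for w
    by (simp add: laplacian_def B_def K_def)
  have u1: "(\<Sum>i\<in>UNIV. \<Sum>j\<in>UNIV. B i j * (pd j (pd i c) x * u)) = u * (\<Sum>i\<in>UNIV. \<Sum>j\<in>UNIV. B i j * pd j (pd i c) x)"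
    by (simp add: sum_distrib_left mult_ac)
  have u2: "(\<Sum>i\<in>UNIV. K i * (dc i * u)) = u * (\<Sum>i\<in>UNIV. K i * pd i c x)"
    by (simp add: sum_distrib_left mult_ac dc_def)
  have u3: "(\<Sum>i\<in>UNIV. K i * (c x * p $ i)) = (\<Sum>i\<in>UNIV. p $ i * (c x * K i))"
    by (simp add: mult_ac)
  show ?thesis
    unfolding lower_order_part_def st p1 second_total_\<xi>[OF x u] \<xi>_eq[OF x u] \<eta>_eq[OF x u] L
      B_def[symmetric] K_def[symmetric] DZ_def[symmetric] DDZ_def[symmetric] dc_def[symmetric] \<tau>_def[symmetric]
    by (simp only: distrib_left right_diff_distrib sum.distrib sum_subtractf e1 e2 e3 e4 u1 u2 u3)
      (simp add: mult_ac dc_def sum_distrib_left)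
qed

text \<open>
  The central formula. The terms in \<open>q\<close> and those in \<open>\<Gamma>\<^sup>i p\<^sub>i\<close> carry the same factor
  \<open>c - 2 \<psi>\<close> and assemble, together with \<open>f\<close>, to a multiple of the equation, so that the
  multiplier of a symmetry can be taken to be a function of \<open>x\<close> alone.
\<close>

lemma second_prolongation_conformal:
  assumes ckv: "conformal_killing U g \<zeta> \<psi>" and x: "x \<in> U" and u: "u \<in> J" and q: "transpose q = q"
  shows "second_prolongation \<xi> \<eta> (poisson_eq g f) (x, u, p, q) =
      (c x - 2 * \<psi> x) * poisson_eq g f (x, u, p, q)
      + (\<Sum>i\<in>UNIV. p $ i * (\<Sum>j\<in>UNIV. ginv g x i j * (2 * pd j c x - (2 - real CARD('n)) * pd j \<psi> x)))
      + (u * laplacian g c x + laplacian g b x - (\<Sum>k\<in>UNIV. \<zeta> x $ k * pdx k f (x, u))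
         - (c x * u + b x) * pdu f (x, u) + (c x - 2 * \<psi> x) * f (x, u))"
proof -
  have "\<forall>i j. lie_deriv_metric \<zeta> g i j x = 2 * \<psi> x * g x $ i $ j"
    using ckv x by (auto simp: conformal_killing_def)
  from this[unfolded conformal_killing_iff_raised[OF x]]
  have sc: "symbol_coeff \<xi> \<eta> x u p i j = (c x - 2 * \<psi> x) * ginv g x i j" for i j
    by (simp add: symbol_coeff_affine[OF x u] algebra_simps)
  have "2 * (\<Sum>j\<in>UNIV. ginv g x i j * pd j c x)
          - (\<Sum>j\<in>UNIV. \<Sum>k\<in>UNIV. ginv g x j k * pd j (pd k (\<lambda>y. \<zeta> y $ i)) x)
          - c x * contracted_christoffel g i x
          + (\<Sum>j\<in>UNIV. contracted_christoffel g j x * pd j (\<lambda>y. \<zeta> y $ i) x)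
          - (\<Sum>k\<in>UNIV. \<zeta> x $ k * pd k (contracted_christoffel g i) x) =
     (\<Sum>j\<in>UNIV. ginv g x i j * (2 * pd j c x - (2 - real CARD('n)) * pd j \<psi> x))
     - (c x - 2 * \<psi> x) * contracted_christoffel g i x" for i
  proof -
    have "(\<Sum>j\<in>UNIV. ginv g x i j * (2 * pd j c x - (2 - real CARD('n)) * pd j \<psi> x)) =
       2 * (\<Sum>j\<in>UNIV. ginv g x i j * pd j c x) - (2 - real CARD('n)) * (\<Sum>j\<in>UNIV. ginv g x i j * pd j \<psi> x)"
      by (simp only: right_diff_distrib sum_subtractf sum_distrib_left mult.left_commute)
    then show ?thesis
      using lie_derivative_contracted_christoffel[OF ckv x, of i] by (simp add: algebra_simps)
  qed
  note lin = this
  have "(\<Sum>i\<in>UNIV. \<Sum>j\<in>UNIV. (c x - 2 * \<psi> x) * ginv g x i j * q $ i $ j) =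
     (c x - 2 * \<psi> x) * (\<Sum>i\<in>UNIV. \<Sum>j\<in>UNIV. ginv g x i j * q $ i $ j)"
    by (simp add: sum_distrib_left mult.assoc)
  moreover have "(\<Sum>i\<in>UNIV. p $ i * ((\<Sum>j\<in>UNIV. ginv g x i j * (2 * pd j c x - (2 - real CARD('n)) * pd j \<psi> x))
     - (c x - 2 * \<psi> x) * contracted_christoffel g i x)) =
     (\<Sum>i\<in>UNIV. p $ i * (\<Sum>j\<in>UNIV. ginv g x i j * (2 * pd j c x - (2 - real CARD('n)) * pd j \<psi> x)))
     - (c x - 2 * \<psi> x) * (\<Sum>i\<in>UNIV. contracted_christoffel g i x * p $ i)"
    by (simp only: right_diff_distrib[of "p $ _"] sum_subtractf) (simp add: sum_distrib_left mult_ac)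
  ultimately show ?thesis
    unfolding second_prolongation_poisson_split[OF open_J smooth_f smooth_\<xi> smooth_\<eta> x u q]
      lower_order_part_affine[OF x u] lin sc poisson_eq.simps
    by (simp only:) (simp only: right_diff_distrib[of "c x - 2 * \<psi> x"])
qed

end

section \<open>The determining equations\<close>

text \<open>
  Adding a multiple of \<open>A\<close> moves any symmetric \<open>q\<close> into the hyperplane, because \<open>A\<close> has nonzero trace
  against \<open>B\<close>. The hypothesis on the hyperplane thus becomes an affine identity on all symmetric matrices;
  \<open>q = 0\<close> gives the constant, and \<open>q = C - l B\<close> gives a vanishing sum of squares.
\<close>

lemma symmetric_form_proportional:
  fixes A :: "real^'n::finite^'n" and B C :: "'n \<Rightarrow> 'n \<Rightarrow> real"
  assumes A: "transpose A = A" and tr: "(\<Sum>i\<in>UNIV. \<Sum>j\<in>UNIV. B i j * A $ i $ j) = t" "t \<noteq> 0"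
    and sym: "\<And>i j. B i j = B j i" "\<And>i j. C i j = C j i"
    and H: "\<And>q. transpose q = q \<Longrightarrow> (\<Sum>i\<in>UNIV. \<Sum>j\<in>UNIV. B i j * q $ i $ j) = h \<Longrightarrow>
        (\<Sum>i\<in>UNIV. \<Sum>j\<in>UNIV. C i j * q $ i $ j) + d = 0"
  shows "\<exists>l. (\<forall>i j. C i j = l * B i j) \<and> d = - l * h"
proof -
  define l where "l = (\<Sum>i\<in>UNIV. \<Sum>j\<in>UNIV. C i j * A $ i $ j) / t"
  have key: "(\<Sum>i\<in>UNIV. \<Sum>j\<in>UNIV. C i j * q $ i $ j) - l * (\<Sum>i\<in>UNIV. \<Sum>j\<in>UNIV. B i j * q $ i $ j) + l * h + d = 0"
    if q: "transpose q = q" for q :: "real^'n^'n"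
  proof -
    \<comment> \<open>\<open>q + s A\<close> lies in the hyperplane.\<close>
  define s where "s = (h - (\<Sum>i\<in>UNIV. \<Sum>j\<in>UNIV. B i j * q $ i $ j)) / t"
    have lin: "(\<Sum>i\<in>UNIV. \<Sum>j\<in>UNIV. M i j * (q + s *\<^sub>R A) $ i $ j) =
       (\<Sum>i\<in>UNIV. \<Sum>j\<in>UNIV. M i j * q $ i $ j) + s * (\<Sum>i\<in>UNIV. \<Sum>j\<in>UNIV. M i j * A $ i $ j)" for M
      by (simp add: distrib_left sum.distrib sum_distrib_left mult.left_commute)
    have "transpose (q + s *\<^sub>R A) = q + s *\<^sub>R A"
      using A q by (simp add: transpose_def vec_eq_iff)
    moreover have "(\<Sum>i\<in>UNIV. \<Sum>j\<in>UNIV. B i j * (q + s *\<^sub>R A) $ i $ j) = h"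
      unfolding lin tr using tr(2) by (simp add: s_def)
    ultimately have "(\<Sum>i\<in>UNIV. \<Sum>j\<in>UNIV. C i j * (q + s *\<^sub>R A) $ i $ j) + d = 0"
      by (rule H)
    then show ?thesis unfolding lin using tr(2) by (simp add: l_def s_def field_simps)
  qed
  have "d = - l * h" using key[of 0] by (simp add: transpose_def vec_eq_iff)
  moreover have "C i j = l * B i j" for i j
  proof -
    define q where "q = (\<chi> i j. C i j - l * B i j)"
    have "transpose q = q" using sym by (simp add: q_def transpose_def vec_eq_iff)
    from key[OF this] \<open>d = - l * h\<close>
    have "(\<Sum>i\<in>UNIV. \<Sum>j\<in>UNIV. C i j * q $ i $ j) - l * (\<Sum>i\<in>UNIV. \<Sum>j\<in>UNIV. B i j * q $ i $ j) = 0"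
      by simp
    then have "(\<Sum>i\<in>UNIV. \<Sum>j\<in>UNIV. (C i j - l * B i j) * (C i j - l * B i j)) = 0"
      by (simp add: q_def sum_distrib_left left_diff_distrib sum_subtractf mult.assoc)
    then have "(C i j - l * B i j) * (C i j - l * B i j) = 0"
      by (simp add: sum_nonneg_eq_0_iff sum_nonneg)
    then show ?thesis by simp
  qed
  ultimately show ?thesis by blast
qed

text \<open>
  With \<open>v\<close> the lowered form of \<open>w\<close>, the hypothesis becomes \<open>w\<^sup>i v\<^sub>m = k \<delta>\<^sup>i\<^sub>m\<close>. Two
  different indices, available in dimension at least two, give \<open>k\<^sup>2 = 0\<close>.
\<close>

lemma (in coordinate_metric) ginv_not_rank_one:
  assumes x: "x \<in> U" and n: "CARD('n) \<ge> 2" and w: "\<And>i j. w i * w j = k * ginv g x i j"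
  shows "w i = 0"
proof -
  define v where "v m = (\<Sum>j\<in>UNIV. w j * g x $ j $ m)" for m
  have wv: "w i * v m = (if i = m then k else 0)" for i m
  proof -
    have "w i * v m = (\<Sum>j\<in>UNIV. (w i * w j) * g x $ j $ m)"
      by (simp add: v_def sum_distrib_left mult.assoc)
    also have "\<dots> = k * (\<Sum>j\<in>UNIV. ginv g x i j * g x $ j $ m)"
      unfolding w by (simp add: sum_distrib_left mult.assoc)
    finally show ?thesis by (simp add: ginv_metric[OF x])
  qed
  obtain m where m: "m \<noteq> i"
  proof (rule ccontr)
    assume "\<not> thesis"
    then have "UNIV = {i}" using that by blast
    then have "CARD('n) = card {i}" by (rule arg_cong)
    then show False using n by simp
  qed
  have "k * k = (w i * v i) * (w m * v m)" unfolding wv by simp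
  also have "\<dots> = (w i * v m) * (w m * v i)" by (simp add: mult_ac)
  finally have "k * k = (w i * v m) * (w m * v i)" .
  then have "k = 0" using wv[of i m] m by simp
  then show ?thesis using w[of i i] by simp
qed

text \<open>
  The metric may be indefinite, so a given \<open>p\<close> can be null; by polarisation the
  quadratic form is still not identically zero.
\<close>

lemma (in coordinate_metric) ginv_quadratic_form_nonzero:
  assumes x: "x \<in> U" and Q: "\<And>p :: real^'n. e * (\<Sum>i\<in>UNIV. \<Sum>j\<in>UNIV. ginv g x i j * (p $ i * p $ j)) = 0"
  shows "e = 0"
proof (rule ccontr)
  assume "e \<noteq> 0"
  then have Q: "(\<Sum>i\<in>UNIV. \<Sum>j\<in>UNIV. ginv g x i j * (p $ i * p $ j)) = 0" for p :: "real^'n"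
    using Q[of p] by simp
  have bil: "(\<Sum>i\<in>UNIV. \<Sum>j\<in>UNIV. ginv g x i j * (axis a 1 $ i * axis b 1 $ j)) = ginv g x a b" for a b
  proof -
    have "(\<Sum>j\<in>UNIV. ginv g x i j * (axis a 1 $ i * axis b 1 $ j)) = (if i = a then ginv g x i b else 0)" for i
      by (simp add: axis_def if_distrib[of "\<lambda>y. _ * y"] cong: if_cong)
    then show ?thesis by (simp add: axis_def)
  qed
  have "ginv g x a b = 0" for a b
  proof -
    have "(\<Sum>i\<in>UNIV. \<Sum>j\<in>UNIV. ginv g x i j * ((axis a 1 + axis b 1) $ i * (axis a 1 + axis b 1) $ j)) =
        ginv g x a a + ginv g x a b + ginv g x b a + ginv g x b b"
      by (simp only: vector_add_component distrib_left distrib_right sum.distrib bil add.assoc)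
    then show ?thesis
      using Q[of "axis a 1 + axis b 1"] Q[of "axis a 1"] Q[of "axis b 1"] ginv_commute[OF x, of a b] bil by simp
  qed
  then show False using metric_ginv[OF x, of undefined undefined] by simp
qed

locale poisson_symmetry = coordinate_metric U g for U :: "(real^'n::finite) set" and g +
  fixes J :: "real set" and \<xi> :: "'n jet0 \<Rightarrow> real^'n" and \<eta> f :: "'n jet0 \<Rightarrow> real"
  assumes open_J: "open J" and connected_J: "connected J"
    and smooth_f: "smooth_on (U \<times> J) f" and smooth_\<xi>: "smooth_on (U \<times> J) \<xi>" and smooth_\<eta>: "smooth_on (U \<times> J) \<eta>"
    and dim: "CARD('n) \<ge> 2"
    and symmetry: "lie_point_symmetry (U \<times> J) (poisson_eq g f) \<xi> \<eta>"
begin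

lemma prolongation_annihilates:
  assumes "x \<in> U" "u \<in> J" "transpose q = q" "poisson_eq g f (x, u, p, q) = 0"
  shows "second_prolongation \<xi> \<eta> (poisson_eq g f) (x, u, p, q) = 0"
proof -
  obtain \<mu> where "\<forall>x u p q. (x, u) \<in> U \<times> J \<and> transpose q = q \<longrightarrow>
      second_prolongation \<xi> \<eta> (poisson_eq g f) (x, u, p, q) = \<mu> (x, u, p, q) * poisson_eq g f (x, u, p, q)"
    using symmetry unfolding lie_point_symmetry_def by blast
  then show ?thesis using assms by (simp del: second_prolongation.simps poisson_eq.simps)
qed

lemma smooth_\<xi>_nth: "smooth_on (U \<times> J) (\<lambda>z. \<xi> z $ k)"
  by (intro smooth_on_nth open_Times open_U open_J smooth_\<xi>)

lemma symbol_proportional: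
  assumes x: "x \<in> U" and u: "u \<in> J"
  shows "\<exists>l. (\<forall>i j. symbol_coeff \<xi> \<eta> x u p i j = l * ginv g x i j) \<and>
     lower_order_part f \<xi> \<eta> x u p = - l * ((\<Sum>i\<in>UNIV. contracted_christoffel g i x * p $ i) + f (x, u))"
proof (rule symmetric_form_proportional)
  show "transpose (g x) = g x" using metric x by (simp add: metric_on_def)
  show "(\<Sum>i\<in>UNIV. \<Sum>j\<in>UNIV. ginv g x i j * g x $ i $ j) = real CARD('n)"
    by (rule ginv_metric_contract[OF x])
  fix q :: "real^'n^'n"
  assume q: "transpose q = q" "(\<Sum>i\<in>UNIV. \<Sum>j\<in>UNIV. ginv g x i j * q $ i $ j) =
    (\<Sum>i\<in>UNIV. contracted_christoffel g i x * p $ i) + f (x, u)"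
  then have "poisson_eq g f (x, u, p, q) = 0" by simp
  from prolongation_annihilates[OF x u q(1) this]
  show "(\<Sum>i\<in>UNIV. \<Sum>j\<in>UNIV. symbol_coeff \<xi> \<eta> x u p i j * q $ i $ j) + lower_order_part f \<xi> \<eta> x u p = 0"
    by (simp only: second_prolongation_poisson_split[OF open_J smooth_f smooth_\<xi> smooth_\<eta> x u q(1)])
qed (use x in \<open>auto intro: ginv_commute symbol_coeff_commute\<close>)

text \<open>
  Compare \<open>p\<close> with \<open>0\<close>: the difference of the coefficients of \<open>q\<close> is linear in \<open>p\<close> and still a multiple of the inverse
  metric. The choice of \<open>p\<close> as the lowered form of \<open>w = \<partial>\<^sub>u \<xi>\<close> turns it into
  \<open>- 2 w\<^sup>i w\<^sup>j\<close> up to such a multiple.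
\<close>

lemma pdu_\<xi>_zero:
  assumes x: "x \<in> U" and u: "u \<in> J"
  shows "pdu (\<lambda>z. \<xi> z $ k) (x, u) = 0"
proof -
  define w where "w k = pdu (\<lambda>z. \<xi> z $ k) (x, u)" for k
  \<comment> \<open>\<open>p\<close> is \<open>w\<close> with its index lowered, so that raising it gives \<open>w\<close> back.\<close>
  define p where "p = (\<chi> k. \<Sum>m\<in>UNIV. g x $ k $ m * w m)"
  have raise: "(\<Sum>k\<in>UNIV. ginv g x i k * p $ k) = w i" for i
    using raise_index[OF x, of i w] by (simp add: p_def)
  have T: "total_deriv0 i (\<lambda>z. \<xi> z $ k) (x, u, r) = pdx i (\<lambda>z. \<xi> z $ k) (x, u) + r $ i * w k" for r i k
    unfolding w_def by (rule total_deriv0_eq[OF smooth_on_differentiable[OF smooth_\<xi>_nth]]) (use x u in simp)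
  have diff: "symbol_coeff \<xi> \<eta> x u p i j - symbol_coeff \<xi> \<eta> x u 0 i j
     = - ginv g x i j * (\<Sum>k\<in>UNIV. p $ k * w k) - 2 * (w i * w j)" for i j
  proof -
    have "(\<Sum>k\<in>UNIV. ginv g x i k * (p $ k * w j)) = w i * w j" for i j
      unfolding raise[of i, symmetric] by (simp add: sum_distrib_right mult.assoc)
    then show ?thesis
      unfolding symbol_coeff_def T w_def[symmetric]
      by (simp add: distrib_left sum.distrib right_diff_distrib mult.commute)
  qed
  obtain l l0 where l: "symbol_coeff \<xi> \<eta> x u p i j = l * ginv g x i j"
      "symbol_coeff \<xi> \<eta> x u 0 i j = l0 * ginv g x i j" for i j
    using symbol_proportional[OF x u, of p] symbol_proportional[OF x u, of 0] by blast
  have "w i * w j = - ((l - l0 + (\<Sum>k\<in>UNIV. p $ k * w k)) / 2) * ginv g x i j" for i j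
    using diff[of i j] unfolding l by (simp add: field_simps)
  from ginv_not_rank_one[OF x dim this] show ?thesis by (simp add: w_def)
qed

lemma \<xi>_independent:
  assumes "x \<in> U" "u \<in> J" "u\<^sub>0 \<in> J"
  shows "\<xi> (x, u) = \<xi> (x, u\<^sub>0)"
  using affine_of_constant_pdu[OF smooth_\<xi>_nth open_J connected_J assms(1) pdu_\<xi>_zero assms(2,3)] assms(1)
  by (simp add: vec_eq_iff)

text \<open>
  Once \<open>\<xi>\<close> depends on \<open>x\<close> only, the factor of proportionality does not depend on \<open>p\<close>, so the
  term without \<open>q\<close> must be affine in \<open>p\<close>. Its second difference about \<open>p = 0\<close> isolates the quadratic part.
\<close>

lemma pdu_pdu_\<eta>_zero:
  assumes x: "x \<in> U" and u: "u \<in> J"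
  shows "pdu (pdu \<eta>) (x, u) = 0"
proof -
  define \<zeta> where "\<zeta> y = \<xi> (y, u)" for y
  have z: "(x, u) \<in> U \<times> J" using x u by simp
  have sz: "smooth_on U \<zeta>" unfolding \<zeta>_def[abs_def] by (rule smooth_on_slice[OF open_U u smooth_\<xi>])
  have "\<xi> (y, v) = \<zeta> y" if "y \<in> U" "v \<in> J" for y v
    unfolding \<zeta>_def by (rule \<xi>_independent[OF that u])
  then interpret xi: affine_field U g J \<xi> "\<lambda>_. 0" f \<zeta> "\<lambda>_. 0" "\<lambda>_. 0"
    by unfold_locales (simp_all add: open_J smooth_f smooth_\<xi> sz smooth_on_const)
  define K where "K i = contracted_christoffel g i x" for i
  define \<alpha> where "\<alpha> i = pdx i \<eta> (x, u)" for i
  define \<beta> where "\<beta> = pdu \<eta> (x, u)"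
  define \<alpha>2 where "\<alpha>2 i j = pdx j (pdx i \<eta>) (x, u)" for i j
  define \<beta>1 where "\<beta>1 i = pdu (pdx i \<eta>) (x, u)" for i
  define \<beta>2 where "\<beta>2 j = pdx j (pdu \<eta>) (x, u)" for j
  define e where "e = pdu (pdu \<eta>) (x, u)"
  define \<sigma> where "\<sigma> i j k = pd j (pd i (\<lambda>y. \<zeta> y $ k)) x" for i j k
  define \<delta> where "\<delta> i j = pd i (\<lambda>y. \<zeta> y $ j) x" for i j
  define \<tau> where "\<tau> i = (\<Sum>k\<in>UNIV. \<xi> (x, u) $ k * pd k (contracted_christoffel g i) x)" for i
  \<comment> \<open>All coefficients are given names that do not mention \<open>p\<close>, so that \<open>lo\<close> is a visible polynomial in \<open>p\<close>.\<close>
  have st: "second_total \<eta> i j (x, u, p) = \<alpha>2 i j + p $ j * \<beta>1 i + p $ i * (\<beta>2 j + p $ j * e)" for i j p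
    unfolding second_total_def \<alpha>2_def \<beta>1_def \<beta>2_def e_def
    by (simp add: total_deriv0_eq[OF smooth_on_differentiable[OF smooth_on_pdx[OF smooth_\<eta>] z]]
        total_deriv0_eq[OF smooth_on_differentiable[OF smooth_on_pdu[OF smooth_\<eta>] z]] del: total_deriv0.simps)
  have p1: "prolong1 \<xi> \<eta> i (x, u, p) = \<alpha> i + p $ i * \<beta> - (\<Sum>j\<in>UNIV. p $ j * \<delta> i j)" for i p
    by (simp add: xi.total_deriv0_\<xi>[OF x u] total_deriv0_eq[OF smooth_on_differentiable[OF smooth_\<eta> z]]
        \<alpha>_def \<beta>_def \<delta>_def del: total_deriv0.simps)
  define lo where "lo = lower_order_part f \<xi> \<eta> x u"
  have lo: "lo p = (\<Sum>i\<in>UNIV. \<Sum>j\<in>UNIV. ginv g x i j *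
      (\<alpha>2 i j + p $ j * \<beta>1 i + p $ i * (\<beta>2 j + p $ j * e) - (\<Sum>k\<in>UNIV. p $ k * \<sigma> i j k)))
     - (\<Sum>i\<in>UNIV. K i * (\<alpha> i + p $ i * \<beta> - (\<Sum>j\<in>UNIV. p $ j * \<delta> i j)) + \<tau> i * p $ i)
     - ((\<Sum>k\<in>UNIV. \<xi> (x, u) $ k * pdx k f (x, u)) + \<eta> (x, u) * pdu f (x, u))" for p
    unfolding lo_def lower_order_part_def st p1 xi.second_total_\<xi>[OF x u] \<sigma>_def K_def \<tau>_def by simp
  have even: "lo p + lo (- p) - 2 * lo 0 = 2 * (e * (\<Sum>i\<in>UNIV. \<Sum>j\<in>UNIV. ginv g x i j * (p $ i * p $ j)))" for p
    unfolding lo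
    by (simp add: distrib_left right_diff_distrib sum.distrib sum_subtractf sum_negf sum_distrib_left mult_ac)
  obtain l where l: "\<And>p i j. symbol_coeff \<xi> \<eta> x u p i j = l p * ginv g x i j"
      "\<And>p. lo p = - l p * ((\<Sum>i\<in>UNIV. K i * p $ i) + f (x, u))"
    using choice[of "\<lambda>p l. (\<forall>i j. symbol_coeff \<xi> \<eta> x u p i j = l * ginv g x i j) \<and>
        lo p = - l * ((\<Sum>i\<in>UNIV. K i * p $ i) + f (x, u))"] symbol_proportional[OF x u]
    unfolding K_def lo_def by blast
  have l0: "l p = l 0" for p
  proof -
    have "symbol_coeff \<xi> \<eta> x u p i j = symbol_coeff \<xi> \<eta> x u 0 i j" for i j
      by (simp add: symbol_coeff_def xi.total_deriv0_\<xi>[OF x u] pdu_\<xi>_zero[OF x u] del: total_deriv0.simps)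
    then have "l p * ginv g x i j = l 0 * ginv g x i j" for i j by (simp add: l(1))
    then have "(\<Sum>k\<in>UNIV. g x $ i $ k * (l p * ginv g x k i)) = (\<Sum>k\<in>UNIV. g x $ i $ k * (l 0 * ginv g x k i))" for i
      by (simp only:)
    then have "l p * (\<Sum>k\<in>UNIV. g x $ i $ k * ginv g x k i) = l 0 * (\<Sum>k\<in>UNIV. g x $ i $ k * ginv g x k i)" for i
      by (simp only: sum_distrib_left mult.left_commute)
    then show ?thesis by (simp add: metric_ginv[OF x])
  qed
  have "lo p + lo (- p) - 2 * lo 0 = 0" for p
    unfolding l(2) l0[of p] l0[of "- p"] by (simp add: sum_negf algebra_simps)
  then have "e * (\<Sum>i\<in>UNIV. \<Sum>j\<in>UNIV. ginv g x i j * (p $ i * p $ j)) = 0" for p :: "real^'n"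
    using even[of p] by simp
  from ginv_quadratic_form_nonzero[OF x this] show ?thesis by (simp add: e_def)
qed

text \<open>
  The functions \<open>\<zeta>\<close>, \<open>c\<close>, \<open>b\<close> are read off on a slice \<open>u = u\<^sub>0\<close>, which makes them smooth.
  The pointwise factor of proportionality has no evident smoothness; \<open>\<psi>\<close> is therefore defined as a normalised trace
  of the Lie derivative of the metric. Both remaining equations come from the central formula at points of the
  equation, which exist over every \<open>(x, u, p)\<close>: take \<open>q\<close> a multiple of the metric.
\<close>

lemma determining_equations:
  assumes J: "J \<noteq> {}"
  obtains \<zeta> \<psi> c b where "conformal_killing U g \<zeta> \<psi>" "smooth_on U c" "smooth_on U b"
    "\<And>x u. x \<in> U \<Longrightarrow> u \<in> J \<Longrightarrow> \<xi> (x, u) = \<zeta> x"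
    "\<And>x u. x \<in> U \<Longrightarrow> u \<in> J \<Longrightarrow> \<eta> (x, u) = c x * u + b x"
    "\<And>x j. x \<in> U \<Longrightarrow> 2 * pd j c x = (2 - real CARD('n)) * pd j \<psi> x"
    "\<And>x u. x \<in> U \<Longrightarrow> u \<in> J \<Longrightarrow>
        u * laplacian g c x + laplacian g b x - (\<Sum>k\<in>UNIV. \<zeta> x $ k * pdx k f (x, u))
         - (c x * u + b x) * pdu f (x, u) + (c x - 2 * \<psi> x) * f (x, u) = 0"
proof -
  obtain u0 where u0: "u0 \<in> J" using J by blast
  define \<zeta> where "\<zeta> x = \<xi> (x, u0)" for x
  define c where "c x = pdu \<eta> (x, u0)" for x
  define b where "b x = \<eta> (x, u0) - c x * u0" for x
  define \<psi> where "\<psi> x = (\<Sum>i\<in>UNIV. \<Sum>j\<in>UNIV. ginv g x i j * lie_deriv_metric \<zeta> g i j x) / (2 * real CARD('n))" for x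
  have sz: "smooth_on U \<zeta>" unfolding \<zeta>_def[abs_def] by (rule smooth_on_slice[OF open_U u0 smooth_\<xi>])
  have sc: "smooth_on U c" unfolding c_def[abs_def] by (rule smooth_on_slice[OF open_U u0 smooth_on_pdu[OF smooth_\<eta>]])
  have sb: "smooth_on U b" unfolding b_def[abs_def]
    by (intro smooth_intros open_U sc smooth_on_slice[OF open_U u0 smooth_\<eta>])
  have sp: "smooth_on U \<psi>" unfolding \<psi>_def[abs_def] lie_deriv_metric_def
    by (intro smooth_intros open_U smooth_ginv smooth_metric sz) auto
  have xi: "\<xi> (x, u) = \<zeta> x" if "x \<in> U" "u \<in> J" for x u
    unfolding \<zeta>_def using \<xi>_independent that u0 by blast
  have eta: "\<eta> (x, u) = c x * u + b x" if x: "x \<in> U" and u: "u \<in> J" for x u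
  proof -
    have "pdu \<eta> (x, v) = c x" if "v \<in> J" for v
      using affine_of_constant_pdu[OF smooth_on_pdu[OF smooth_\<eta>] open_J connected_J x pdu_pdu_\<eta>_zero[OF x] that u0]
      by (simp add: c_def)
    from affine_of_constant_pdu[OF smooth_\<eta> open_J connected_J x this u u0]
    show ?thesis by (simp add: b_def algebra_simps)
  qed
  interpret affine_field U g J \<xi> \<eta> f \<zeta> c b
    by unfold_locales (use open_J smooth_f smooth_\<xi> smooth_\<eta> sz sc sb xi eta in auto)
  have ckv: "conformal_killing U g \<zeta> \<psi>"
  proof -
    have "\<forall>i j. lie_deriv_metric \<zeta> g i j x = 2 * \<psi> x * g x $ i $ j" if x: "x \<in> U" for x
    proof -
      obtain l where l: "\<And>i j. symbol_coeff \<xi> \<eta> x u0 0 i j = l * ginv g x i j"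
        using symbol_proportional[OF x u0, of 0] by blast
      define k where "k = (c x - l) / 2"
      have "- 2 * k * ginv g x i j = l * ginv g x i j - c x * ginv g x i j" for i j
        by (simp add: k_def left_diff_distrib)
      then have L: "\<forall>i j. lie_deriv_metric \<zeta> g i j x = 2 * k * g x $ i $ j"
        unfolding conformal_killing_iff_raised[OF x] using l[unfolded symbol_coeff_affine[OF x u0]]
        by (simp add: algebra_simps)
      have "(\<Sum>i\<in>UNIV. \<Sum>j\<in>UNIV. ginv g x i j * lie_deriv_metric \<zeta> g i j x) =
          2 * k * (\<Sum>i\<in>UNIV. \<Sum>j\<in>UNIV. ginv g x i j * g x $ i $ j)"
        using L by (simp add: sum_distrib_left mult.left_commute)
      then have "\<psi> x = k" unfolding \<psi>_def ginv_metric_contract[OF x] by simp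
      then show ?thesis using L by simp
    qed
    then show ?thesis using sz sp by (auto simp: conformal_killing_def)
  qed
  define v where "v x i = (\<Sum>j\<in>UNIV. ginv g x i j * (2 * pd j c x - (2 - real CARD('n)) * pd j \<psi> x))" for x i
  define r where "r x u = u * laplacian g c x + laplacian g b x - (\<Sum>k\<in>UNIV. \<zeta> x $ k * pdx k f (x, u))
         - (c x * u + b x) * pdu f (x, u) + (c x - 2 * \<psi> x) * f (x, u)" for x u
  have lin: "(\<Sum>i\<in>UNIV. p $ i * v x i) + r x u = 0" if x: "x \<in> U" and u: "u \<in> J" for x u p
  proof -
    define s where "s = ((\<Sum>i\<in>UNIV. contracted_christoffel g i x * p $ i) + f (x, u)) / real CARD('n)"
    have q: "transpose (s *\<^sub>R g x) = s *\<^sub>R g x"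
      using metric x by (simp add: metric_on_def transpose_scalar)
    have "(\<Sum>i\<in>UNIV. \<Sum>j\<in>UNIV. ginv g x i j * (s *\<^sub>R g x) $ i $ j) =
        s * (\<Sum>i\<in>UNIV. \<Sum>j\<in>UNIV. ginv g x i j * g x $ i $ j)"
      by (simp add: sum_distrib_left mult.left_commute)
    then have H: "poisson_eq g f (x, u, p, s *\<^sub>R g x) = 0"
      by (simp add: ginv_metric_contract[OF x] s_def)
    from prolongation_annihilates[OF x u q H] show ?thesis
      unfolding second_prolongation_conformal[OF ckv x u q] H v_def r_def by simp
  qed
  have r: "r x u = 0" if "x \<in> U" "u \<in> J" for x u
    using lin[OF that, of 0] by simp
  have v: "v x i = 0" if x: "x \<in> U" for x i
  proof -
    have "(\<Sum>j\<in>UNIV. axis i 1 $ j * v x j) = v x i"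
      by (simp add: axis_def if_distrib[of "\<lambda>a. a * _"] cong: if_cong)
    then show ?thesis using lin[OF x u0, of "axis i 1"] r[OF x u0] by simp
  qed
  have "2 * pd j c x = (2 - real CARD('n)) * pd j \<psi> x" if x: "x \<in> U" for x j
    using lower_index[OF x, of j "\<lambda>j. 2 * pd j c x - (2 - real CARD('n)) * pd j \<psi> x", folded v_def] v[OF x] by simp
  with that[OF ckv sc sb xi eta] r[unfolded r_def] show ?thesis by blast
qed

end

lemma constant_of_zero_pd:
  fixes F :: "real^'n::finite \<Rightarrow> real"
  assumes "open U" "connected U" "smooth_on U F" "\<And>x i. x \<in> U \<Longrightarrow> pd i F x = 0"
  obtains k where "\<And>x. x \<in> U \<Longrightarrow> F x = k"
proof -
  have "(F has_derivative (\<lambda>h. 0)) (at x within U)" if "x \<in> U" for x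
  proof -
    have "frechet_derivative F (at x) = (\<lambda>h. 0)"
      using assms(4)[OF that] by (auto simp: frechet_derivative_eq_sum_pd[OF smooth_on_differentiable[OF assms(3) that]])
    then show ?thesis
      using smooth_on_has_derivative[OF assms(3) that] has_derivative_at_withinI by metis
  qed
  then have "F constant_on U"
    using has_derivative_zero_connected_constant_on[OF assms(2,1) finite.emptyI smooth_on_continuous_on[OF assms(3)]] by simp
  then show ?thesis using that unfolding constant_on_def by blast
qed

text \<open>
  One formula for all dimensions \<open>n \<ge> 2\<close>. The converse direction yields the multiplier \<open>c - 2 \<psi>\<close>
  explicitly.
\<close>

theorem (in coordinate_metric) lie_point_symmetry_poisson_iff:
  fixes J :: "real set" and f \<eta> :: "'n jet0 \<Rightarrow> real" and n :: real
  assumes U: "connected U" and J: "open J" "connected J"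
    and sm: "smooth_on (U \<times> J) f" "smooth_on (U \<times> J) \<xi>" "smooth_on (U \<times> J) \<eta>"
    and n: "n = real CARD('n)" "CARD('n) \<ge> 2"
  shows "lie_point_symmetry (U \<times> J) (poisson_eq g f) \<xi> \<eta> \<longleftrightarrow>
        (\<exists>\<zeta> \<psi> b. \<exists>a\<^sub>0::real.
           conformal_killing U g \<zeta> \<psi> \<and> smooth_on U b \<and>
           (\<forall>x\<in>U. \<forall>u\<in>J.
              \<xi> (x, u) = \<zeta> x \<and>
              \<eta> (x, u) = (2 - n) / 2 * \<psi> x * u + a\<^sub>0 * u + b x \<and>
              (2 - n) / 2 * laplacian g \<psi> x * u
              + (\<Sum>i\<in>UNIV. \<Sum>j\<in>UNIV. ginv g x i j * cov_hessian g b i j x)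
              - (\<Sum>k\<in>UNIV. \<zeta> x $ k * pdx k f (x, u))
              - (2 - n) / 2 * \<psi> x * u * pdu f (x, u)
              - a\<^sub>0 * u * pdu f (x, u) + a\<^sub>0 * f (x, u)
              - (n + 2) / 2 * \<psi> x * f (x, u)
              - b x * pdu f (x, u) = 0))"
    (is "?L \<longleftrightarrow> (\<exists>\<zeta> \<psi> b. \<exists>a\<^sub>0. ?P \<zeta> \<psi> b a\<^sub>0)")
proof
  assume sym: ?L
  show "\<exists>\<zeta> \<psi> b. \<exists>a\<^sub>0. ?P \<zeta> \<psi> b a\<^sub>0"
    \<comment> \<open>Over empty \<open>J\<close> nothing is known of the field, but the zero conformal Killing vector will do.\<close>
  proof (cases "J = {}")
    case True
    have "pd k (\<lambda>y. 0) x = 0" for k and x :: "real^'n" by simp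
    then have "conformal_killing U g (\<lambda>_. 0) (\<lambda>_. 0)"
      by (simp add: conformal_killing_def smooth_on_const lie_deriv_metric_def)
    then have "?P (\<lambda>_. 0) (\<lambda>_. 0) (\<lambda>_. 0) 0"
      using True by (simp add: smooth_on_const)
    then show ?thesis by blast
  next
    case False
    interpret poisson_symmetry U g J \<xi> \<eta> f
      by unfold_locales (use J sm n sym in auto)
    show ?thesis
    proof (rule determining_equations[OF False])
      fix \<zeta> \<psi> c b
      assume ckv: "conformal_killing U g \<zeta> \<psi>" and sc: "smooth_on U c" and sb: "smooth_on U b"
      and xi: "\<And>x u. x \<in> U \<Longrightarrow> u \<in> J \<Longrightarrow> \<xi> (x, u) = \<zeta> x"
      and eta: "\<And>x u. x \<in> U \<Longrightarrow> u \<in> J \<Longrightarrow> \<eta> (x, u) = c x * u + b x"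
      and lin: "\<And>x j. x \<in> U \<Longrightarrow> 2 * pd j c x = (2 - real CARD('n)) * pd j \<psi> x"
      and const: "\<And>x u. x \<in> U \<Longrightarrow> u \<in> J \<Longrightarrow>
        u * laplacian g c x + laplacian g b x - (\<Sum>k\<in>UNIV. \<zeta> x $ k * pdx k f (x, u))
         - (c x * u + b x) * pdu f (x, u) + (c x - 2 * \<psi> x) * f (x, u) = 0"
      have sp: "smooth_on U \<psi>" using ckv by (simp add: conformal_killing_def)
      have "pd i (\<lambda>y. c y - (2 - n) / 2 * \<psi> y) x = 0" if "x \<in> U" for i x
      proof -
        have "pd i (\<lambda>y. c y - (2 - n) / 2 * \<psi> y) x = pd i c x - pd i (\<lambda>y. (2 - n) / 2 * \<psi> y) x"
          by (rule pd_diff[OF sc smooth_on_mult[OF open_U smooth_on_const sp] that])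
        also have "pd i (\<lambda>y. (2 - n) / 2 * \<psi> y) x = (2 - n) / 2 * pd i \<psi> x"
          by (rule pd_cmult[OF sp that])
        finally show ?thesis using lin[OF that, of i] by (simp add: n(1) field_simps)
      qed
      moreover have "smooth_on U (\<lambda>y. c y - (2 - n) / 2 * \<psi> y)"
        by (intro smooth_on_diff smooth_on_mult smooth_on_const open_U sc sp)
      ultimately obtain a where "\<And>x. x \<in> U \<Longrightarrow> c x - (2 - n) / 2 * \<psi> x = a"
        using constant_of_zero_pd[OF open_U U] by blast
      then have c: "c x = (2 - n) / 2 * \<psi> x + a" if "x \<in> U" for x
        using that by force
      have "?P \<zeta> \<psi> b a"
      proof (intro conjI ckv sb ballI)
        fix x u assume x: "x \<in> U" and u: "u \<in> J"
        show "\<xi> (x, u) = \<zeta> x" by (rule xi[OF x u])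
        show "\<eta> (x, u) = (2 - n) / 2 * \<psi> x * u + a * u + b x"
          by (simp add: eta[OF x u] c[OF x] algebra_simps)
        have lap: "laplacian g c x = (2 - n) / 2 * laplacian g \<psi> x"
          by (rule laplacian_affine[OF sp x]) (rule c)
        show "(2 - n) / 2 * laplacian g \<psi> x * u
                + (\<Sum>i\<in>UNIV. \<Sum>j\<in>UNIV. ginv g x i j * cov_hessian g b i j x)
                - (\<Sum>k\<in>UNIV. \<zeta> x $ k * pdx k f (x, u))
                - (2 - n) / 2 * \<psi> x * u * pdu f (x, u)
                - a * u * pdu f (x, u) + a * f (x, u)
                - (n + 2) / 2 * \<psi> x * f (x, u)
                - b x * pdu f (x, u) = 0"
          using const[OF x u] unfolding contract_cov_hessian lap c[OF x]
          by (simp add: field_simps)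
      qed
      then show ?thesis by blast
    qed
  qed
next
  assume "\<exists>\<zeta> \<psi> b. \<exists>a\<^sub>0. ?P \<zeta> \<psi> b a\<^sub>0"
  then obtain \<zeta> \<psi> b a where P: "?P \<zeta> \<psi> b a" by blast
  then have ckv: "conformal_killing U g \<zeta> \<psi>" and sb: "smooth_on U b" by auto
  define c where "c x = (2 - n) / 2 * \<psi> x + a" for x
  have sz: "smooth_on U \<zeta>" and sp: "smooth_on U \<psi>" using ckv by (auto simp: conformal_killing_def)
  have sc: "smooth_on U c" unfolding c_def[abs_def] by (intro smooth_intros open_U sp)
  interpret affine_field U g J \<xi> \<eta> f \<zeta> c b
    by unfold_locales (use J sm sz sc sb P in \<open>auto simp: c_def algebra_simps\<close>)
  have "second_prolongation \<xi> \<eta> (poisson_eq g f) (x, u, p, q) = (c x - 2 * \<psi> x) * poisson_eq g f (x, u, p, q)"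
    if x: "x \<in> U" and u: "u \<in> J" and q: "transpose q = q" for x u p q
  proof -
    have lap: "laplacian g c x = (2 - n) / 2 * laplacian g \<psi> x"
      by (rule laplacian_affine[OF sp x]) (rule c_def)
    have "pd j (\<lambda>y. k * \<psi> y + a) x = k * pd j \<psi> x" for j k
      by (simp add: pd_add[of U] pd_cmult[of U] sp smooth_on_mult smooth_on_const open_U x)
    from this[of _ "(2 - n) / 2", folded c_def]
    have pdc: "2 * pd j c x - (2 - real CARD('n)) * pd j \<psi> x = 0" for j
      by (simp add: n(1) mult.commute)
    have "(2 - n) / 2 * laplacian g \<psi> x * u
              + laplacian g b x
              - (\<Sum>k\<in>UNIV. \<zeta> x $ k * pdx k f (x, u))
              - (2 - n) / 2 * \<psi> x * u * pdu f (x, u)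
              - a * u * pdu f (x, u) + a * f (x, u)
              - (n + 2) / 2 * \<psi> x * f (x, u)
              - b x * pdu f (x, u) = 0"
      using P x u unfolding contract_cov_hessian by blast
    then have "u * laplacian g c x + laplacian g b x - (\<Sum>k\<in>UNIV. \<zeta> x $ k * pdx k f (x, u))
         - (c x * u + b x) * pdu f (x, u) + (c x - 2 * \<psi> x) * f (x, u) = 0"
      unfolding lap c_def by (simp add: field_simps)
    then show ?thesis
      unfolding second_prolongation_conformal[OF ckv x u q] pdc by simp
  qed
  then show ?L
    unfolding lie_point_symmetry_def
    by (intro exI[of _ "\<lambda>(x, u, p, q). c x - 2 * \<psi> x"]) auto
qed

theorem theorem1:
  fixes U :: "(real^'n::finite) set" and J :: "real set"
    and g :: "real^'n \<Rightarrow> real^'n^'n"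
    and f :: "(real^'n) \<times> real \<Rightarrow> real"
    and \<xi> :: "(real^'n) \<times> real \<Rightarrow> real^'n"
    and \<eta> :: "(real^'n) \<times> real \<Rightarrow> real"
    and n :: real
  assumes "open U" and "connected U"
    and "open J" and "connected J"
    and "metric_on U g"
    and "smooth_on (U \<times> J) f"
    and "smooth_on (U \<times> J) \<xi>" and "smooth_on (U \<times> J) \<eta>"
    and "n = real CARD('n)"
  shows
    "(n > 2 \<longrightarrow>
       (lie_point_symmetry (U \<times> J) (poisson_eq g f) \<xi> \<eta> \<longleftrightarrow>
        (\<exists>\<zeta> \<psi> b. \<exists>a\<^sub>0::real.
           conformal_killing U g \<zeta> \<psi> \<and> smooth_on U b \<and>
           (\<forall>x\<in>U. \<forall>u\<in>J.
              \<xi> (x, u) = \<zeta> x \<and>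
              \<eta> (x, u) = (2 - n) / 2 * \<psi> x * u + a\<^sub>0 * u + b x \<and>
              (2 - n) / 2 * laplacian g \<psi> x * u
              + (\<Sum>i\<in>UNIV. \<Sum>j\<in>UNIV. ginv g x i j * cov_hessian g b i j x)
              - (\<Sum>k\<in>UNIV. \<zeta> x $ k * pdx k f (x, u))
              - (2 - n) / 2 * \<psi> x * u * pdu f (x, u)
              - a\<^sub>0 * u * pdu f (x, u) + a\<^sub>0 * f (x, u)
              - (n + 2) / 2 * \<psi> x * f (x, u)
              - b x * pdu f (x, u) = 0)))) \<and>
     (n = 2 \<longrightarrow>
       (lie_point_symmetry (U \<times> J) (poisson_eq g f) \<xi> \<eta> \<longleftrightarrow>
        (\<exists>\<zeta> \<psi> b. \<exists>a\<^sub>0::real.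
           conformal_killing U g \<zeta> \<psi> \<and> smooth_on U b \<and>
           (\<forall>x\<in>U. \<forall>u\<in>J.
              \<xi> (x, u) = \<zeta> x \<and>
              \<eta> (x, u) = a\<^sub>0 * u + b x \<and>
              (\<Sum>i\<in>UNIV. \<Sum>j\<in>UNIV. ginv g x i j * cov_hessian g b i j x)
              - (\<Sum>k\<in>UNIV. \<zeta> x $ k * pdx k f (x, u))
              - a\<^sub>0 * u * pdu f (x, u)
              + (a\<^sub>0 - 2 * \<psi> x) * f (x, u)
              - b x * pdu f (x, u) = 0))))"
proof -
  interpret coordinate_metric U g
    by unfold_locales (fact assms)+
  note iff = lie_point_symmetry_poisson_iff[OF assms(2,3,4,6,7,8)]
  show ?thesis
  proof (intro conjI impI, goal_cases)
    case 1
    then have "CARD('n) \<ge> 2" using assms(9) by simp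
    from iff[OF assms(9) this] show ?case .
  next
    case 2
    then have "(2::real) = real CARD('n)" "CARD('n) \<ge> 2" using assms(9) by simp_all
    from iff[OF this] show ?case
      by (simp add: left_diff_distrib add_diff_eq diff_diff_eq mult.assoc)
  qed
qed

end
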